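(* Let $\mu$ be a probability measure on $\mathbb{Z}_+=\{0,1,2,\dots\}$ with $0<\mu(0)<1$ and whose support is included in $d\mathbb{Z}_+=\{0,d,2d,\dots\}$ for some integer $d\geq 1$. If the sequence $(\mu(kd))_{k\geq 0}$ is log-concave, then the distributions $(\mathbf{BGW}^{\mu}_{nd+1})_{n\geq 0}$ can be coupled as a Markov process $(\mathrm{T}_{nd+1})_{n\geq 0}$ (i.e. $\mathrm{T}_{nd+1}$ has law $\mathbf{BGW}^\mu_{nd+1}$ for every $n\ge0$) such that $\mathrm{T}_1\subset \mathrm{T}_{d+1}\subset \mathrm{T}_{2d+1}\subset\cdots$.
   Context: Trees. The Ulam--Harris tree is the set of finite words $\mathbb{U}=\bigcup_{h\geq 0}\{1,2,\dots\}^h$; the empty word $\varnothing$ is the root, and for $u\in\mathbb{U}$, $i\ge1$, $ui$ is the word $u$ with letter $i$ appended. A plane tree is a non-empty finite subset $T\subset\mathbb{U}$ such that for all $u\in\mathbb{U}$ and $i\in\{1,2,\dots\}$, $ui\in T$ implies $u\in T$ and $uj\in T$ for all $1\leq j\leq i$. $\mathbb{T}_n$ is the set of plane trees with $n$ vertices (elements). For $T$ a plane tree and $u\in T$, $k_u(T)=\#\{i\ge1: ui\in T\}$ is the number of children of $u$ in $T$. Inclusions between plane trees are inclusions of subsets of $\mathbb{U}$. Conditioned Bienaymé--Galton--Watson distributions. $\mathbf{BGW}^\mu(T)=\prod_{u\in T}\mu(k_u(T))$ for every plane tree $T$, and for $n\geq 1$, when $\mathbf{BGW}^{\mu}(\mathbb{T}_n)>0$,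 $\mathbf{BGW}^\mu_n$ is the probability distribution on $\mathbb{T}_n$ given by $\mathbf{BGW}^\mu_n(T)=\mathbf{BGW}^\mu(T)/\mathbf{BGW}^\mu(\mathbb{T}_n)$. (Under the hypotheses of the claim, $\mathbf{BGW}^\mu_{nd+1}$ is well-defined for all $n\ge 0$.) Log-concavity. A non-negative sequence $(x_i)_{i\geq 0}$ is log-concave if $x_i^2\geq x_{i-1}x_{i+1}$ for all $i\geq 1$ and it has no internal zeros, i.e. $x_ix_j\neq 0$ with $i<j$ implies $x_ix_{i+1}\cdots x_j\neq 0$. A coupling of a family of probability distributions is a family of random variables on a common probability space having these respective laws. Markov processes may be time-inhomogeneous. *)

theory Defs
  imports "HOL-Probability.Probability"
begin

text \<open>
  Vertices of the Ulam--Harris tree are lists of positive naturals; the root is \<open>[]\<close> and the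
  \<open>i\<close>-th child of \<open>u\<close> is \<open>u @ [i]\<close>.
\<close>

definition ulam_harris :: "nat list set" where
  "ulam_harris = lists {1..}"

definition plane_trees :: "nat list set set" where
  "plane_trees = {T. T \<noteq> {} \<and> finite T \<and> T \<subseteq> ulam_harris \<and>
     (\<forall>u\<in>ulam_harris. \<forall>i\<ge>1. u @ [i] \<in> T \<longrightarrow> u \<in> T \<and> (\<forall>j\<in>{1..i}. u @ [j] \<in> T))}"

definition plane_trees_of_size :: "nat \<Rightarrow> nat list set set" where
  "plane_trees_of_size n = {T \<in> plane_trees. card T = n}"

definition num_children :: "nat list set \<Rightarrow> nat list \<Rightarrow> nat" where
  "num_children T u = card {i. i \<ge> 1 \<and> u @ [i] \<in> T}"

definition bgw_weight :: "nat pmf \<Rightarrow> nat list set \<Rightarrow> real" where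
  "bgw_weight \<mu> T = (\<Prod>u\<in>T. pmf \<mu> (num_children T u))"

text \<open>The sum ranges over a finite set, see \<open>finite_plane_trees_of_size\<close> below.\<close>

definition bgw_mass :: "nat pmf \<Rightarrow> nat \<Rightarrow> real" where
  "bgw_mass \<mu> n = (\<Sum>T\<in>plane_trees_of_size n. bgw_weight \<mu> T)"

text \<open>
  The law of the tree conditioned to have \<open>n\<close> vertices, as a measure on the discrete space
  of plane trees of size \<open>n\<close>. It is meaningful only if \<open>bgw_mass \<mu> n > 0\<close>: otherwise it is the
  zero measure, which is not the law of any random variable.
\<close>

definition bgw_cond :: "nat pmf \<Rightarrow> nat \<Rightarrow> nat list set measure" where
  "bgw_cond \<mu> n =
     point_measure (plane_trees_of_size n) (\<lambda>T. ennreal (bgw_weight \<mu> T / bgw_mass \<mu> n))"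

definition log_concave_seq :: "(nat \<Rightarrow> real) \<Rightarrow> bool" where
  "log_concave_seq x \<longleftrightarrow>
     (\<forall>i. 0 \<le> x i) \<and>
     (\<forall>i\<ge>1. (x i)\<^sup>2 \<ge> x (i - 1) * x (i + 1)) \<and>
     (\<forall>i j. i < j \<and> x i * x j \<noteq> 0 \<longrightarrow> (\<Prod>k\<in>{i..j}. x k) \<noteq> 0)"

text \<open>
  Possibly time-inhomogeneous Markov process in discrete time with values in a countable
  (discrete) state space. The Markov property is required only for histories of positive
  probability, since \<open>cond_prob\<close> divides by the probability of the condition.
\<close>

definition markov_process :: "'w measure \<Rightarrow> 's set \<Rightarrow> (nat \<Rightarrow> 'w \<Rightarrow> 's) \<Rightarrow> bool" where
  "markov_process M S X \<longleftrightarrow>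
     prob_space M \<and> countable S \<and>
     (\<forall>n. X n \<in> measurable M (count_space S)) \<and>
     (\<forall>n x. \<P>(\<omega> in M. \<forall>i\<le>n. X i \<omega> = x i) > 0 \<longrightarrow>
        (\<forall>y\<in>S. \<P>(\<omega> in M. X (Suc n) \<omega> = y \<bar> \<forall>i\<le>n. X i \<omega> = x i)
              = \<P>(\<omega> in M. X (Suc n) \<omega> = y \<bar> X n \<omega> = x n)))"

lemma take_mem_plane_tree:
  assumes "T \<in> plane_trees" "u \<in> T"
  shows "take k u \<in> T"
proof -
  have step: "v \<in> T" if "v @ [i] \<in> T" for v i
  proof -
    have "v @ [i] \<in> ulam_harris" using assms that by (auto simp: plane_trees_def)
    hence "v \<in> ulam_harris" "i \<ge> 1" by (auto simp: ulam_harris_def)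
    thus ?thesis using assms that unfolding plane_trees_def by blast
  qed
  have "v \<in> T" if "v @ w \<in> T" for v w
    using that
  proof (induction w rule: rev_induct)
    case (snoc i w)
    thus ?case using step[of "v @ w" i] by simp
  qed simp
  from this[of "take k u" "drop k u"] show ?thesis using assms by simp
qed

lemma finite_plane_trees_of_size: "finite (plane_trees_of_size n)"
proof -
  let ?B = "{u. set u \<subseteq> {..n} \<and> length u \<le> n}"
  have "T \<subseteq> ?B" if T: "T \<in> plane_trees_of_size n" for T
  proof
    fix u assume u: "u \<in> T"
    have pt: "T \<in> plane_trees" and c: "card T = n" and fin: "finite T"
      using T by (auto simp: plane_trees_of_size_def plane_trees_def)
    have "inj_on (\<lambda>k. take k u) {..length u}"
      by (rule inj_on_inverseI[where g = length]) simp
    hence "card {..length u} \<le> card T"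
      by (rule card_inj_on_le) (use take_mem_plane_tree[OF pt u] fin in auto)
    hence len: "length u \<le> n" using c by simp
    have "u ! k \<le> n" if k: "k < length u" for k
    proof -
      have m: "take k u @ [u ! k] \<in> T"
        using take_mem_plane_tree[OF pt u, of "Suc k"] k by (simp add: take_Suc_conv_app_nth)
      hence "take k u @ [u ! k] \<in> ulam_harris" using pt by (auto simp: plane_trees_def)
      hence "take k u \<in> ulam_harris" "u ! k \<ge> 1" by (auto simp: ulam_harris_def)
      hence "\<forall>j\<in>{1..u ! k}. take k u @ [j] \<in> T"
        using pt m unfolding plane_trees_def by blast
      hence "(\<lambda>j. take k u @ [j]) ` {1..u ! k} \<subseteq> T" by auto
      hence "card {1..u ! k} \<le> card T"
        by (intro card_inj_on_le[where f = "\<lambda>j. take k u @ [j]"]) (auto simp: inj_on_def fin)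
      thus ?thesis using c by simp
    qed
    hence "set u \<subseteq> {..n}" by (auto simp: in_set_conv_nth)
    with len show "u \<in> ?B" by simp
  qed
  hence "plane_trees_of_size n \<subseteq> Pow ?B" by blast
  thus ?thesis by (rule finite_subset) (simp add: finite_lists_length_le)
qed

lemma prob_space_bgw_cond:
  assumes "bgw_mass \<mu> n > 0"
  shows "prob_space (bgw_cond \<mu> n)"
proof
  have nn: "bgw_weight \<mu> T / bgw_mass \<mu> n \<ge> 0" for T
    using assms by (simp add: bgw_weight_def prod_nonneg)
  have "emeasure (bgw_cond \<mu> n) (space (bgw_cond \<mu> n)) =
          (\<Sum>T\<in>plane_trees_of_size n. ennreal (bgw_weight \<mu> T / bgw_mass \<mu> n))"
    unfolding bgw_cond_def space_point_measure
    by (rule emeasure_point_measure_finite[OF finite_plane_trees_of_size]) simp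
  also have "\<dots> = ennreal (\<Sum>T\<in>plane_trees_of_size n. bgw_weight \<mu> T / bgw_mass \<mu> n)"
    using nn by (simp add: sum_ennreal)
  also have "\<dots> = 1"
    using assms by (simp add: sum_divide_distrib[symmetric] bgw_mass_def[symmetric])
  finally show "emeasure (bgw_cond \<mu> n) (space (bgw_cond \<mu> n)) = 1" .
qed

end

theory Submission
  imports Defs
begin

text \<open>
  If the trees of sizes \<open>nd + 1\<close> and \<open>(n + 1)d + 1\<close> can be coupled so that the first is contained in
  the second, then running the conditional law of the second given the first as a transition kernel
  produces the required increasing Markov chain (\<open>markov_chain_of_couplings\<close>). So everything rests on
  coupling two consecutive conditioned laws.

  Such a coupling is built recursively, by exposing the children of the root one at a time from left
  to right. When \<open>s\<close> children of a vertex have been treated, what remains to be sampled is a forest: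
  its trees are the descendants to come of that vertex, and its weight has a factor
  \<open>\<mu>(s + number of its trees)\<close> for that vertex. A forest is empty, or consists of a first tree and a
  remaining forest in state \<open>s + 1\<close>. Given the total size, the size of the first tree is a random
  variable; if this size can be coupled so that, when \<open>d\<close> vertices are added to the forest, it either
  stays the same or grows by \<open>d\<close>, then only one of the two parts grows, and the coupling of that
  smaller part is given by induction on the size (\<open>forest_law_step\<close>). An empty forest is contained in
  every other one, which starts the induction.

  Measure sizes in units of \<open>d\<close>. Let \<open>a\<close> be the sequence of total weights of trees, \<open>v\<close> that of the
  remaining forests, and \<open>W = a * v\<close>. The size of the first tree takes the value \<open>x\<close> with probability
  \<open>a x * v (m - x) / W m\<close>, and the coupling of sizes exists as soon as
  \<open>a (y + 1) / a y\<close> and \<open>v (y + 1) / v y\<close> are at most \<open>W (m + 1) / W m\<close> for all \<open>y \<le> m\<close>: then, for every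
  \<open>x \<le> m\<close>, the old probability of \<open>x\<close> is at least the new probabilities of \<open>x\<close> and of \<open>x + 1\<close>, and there is
  a flow along the edges \<open>x \<mapsto> x\<close> and \<open>x \<mapsto> x + 1\<close> that turns the old law into the new one
  (\<open>rel_pmf_unit_step\<close>).

  It remains to prove these ratio bounds, and this is where log-concavity enters. Write \<open>p j = \<mu>(jd)\<close>,
  let \<open>A\<close> be the generating function of \<open>a\<close> and \<open>G\<^sub>j\<close> that of the forests in state \<open>jd\<close>. Then \<open>A = G\<^sub>0\<close>,
  \<open>G\<^sub>j = p j + z A\<^sup>d G\<^sub>j\<^sub>+\<^sub>1\<close>, and the sequences \<open>v\<close>, \<open>W\<close> that occur are the coefficients of
  \<open>A\<^sup>i\<^sup>-\<^sup>1 G\<^sub>j\<close> and \<open>A\<^sup>i G\<^sub>j\<close> with \<open>1 \<le> i \<le> d\<close> and \<open>j \<ge> 1\<close>. Order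
  sequences by comparing their ratios of consecutive terms. The claim is that, as long as \<open>p j > 0\<close>,

    \<open>G\<^sub>j \<le> A \<le> A G\<^sub>j \<le> \<dots> \<le> A\<^sup>d G\<^sub>j \<le> A\<^sup>d G\<^sub>1 = (A - p 0) / z\<close>   and   \<open>G\<^sub>j \<le> G\<^sub>j\<^sub>-\<^sub>1\<close>.

  In particular \<open>a\<close> is log-convex. These comparisons are proved together, one coefficient at a
  time (\<open>ratio_bounds\<close>). The engine is \<open>conv_ratio_mono\<close>: if \<open>a\<close> is log-convex and \<open>A \<le> A V\<close>, then
  multiplication by \<open>A\<close> preserves \<open>V \<le> U\<close>. Given the comparisons up to some degree, comparing \<open>G\<^sub>j\<^sub>+\<^sub>1\<close> with
  \<open>G\<^sub>j\<close> one degree further is comparing \<open>A\<^sup>d G\<^sub>j\<^sub>+\<^sub>2\<close> with \<open>A\<^sup>d G\<^sub>j\<^sub>+\<^sub>1\<close>, the lowest degree being the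
  log-concavity of \<open>p\<close>; and comparing \<open>A\<close> with \<open>A G\<^sub>j\<close> one degree further reduces to comparing
  \<open>A\<^sup>d G\<^sub>1\<close> with \<open>A\<^sup>d (A G\<^sub>j\<^sub>+\<^sub>1)\<close>.
\<close>

section \<open>Comparing ratios of consecutive terms\<close>

definition conv :: "(nat \<Rightarrow> real) \<Rightarrow> (nat \<Rightarrow> real) \<Rightarrow> nat \<Rightarrow> real" where
  "conv a v n = (\<Sum>i\<le>n. a i * v (n - i))"

text \<open>
  For positive sequences this says that \<open>u k / v k\<close> is nonincreasing for \<open>k \<le> N\<close>, equivalently that the
  ratios of consecutive terms of \<open>u\<close> are at most those of \<open>v\<close>. Sequences of the form \<open>(c, 0, 0, \<dots>)\<close> do
  occur (vertices that cannot get more children), hence the formulation without division.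
\<close>

definition ratio_le :: "nat \<Rightarrow> (nat \<Rightarrow> real) \<Rightarrow> (nat \<Rightarrow> real) \<Rightarrow> bool" where
  "ratio_le N u v \<longleftrightarrow> (\<forall>i k. i \<le> k \<longrightarrow> k \<le> N \<longrightarrow> u k * v i \<le> u i * v k)"

lemma ratio_leD: "ratio_le N u v \<Longrightarrow> i \<le> k \<Longrightarrow> k \<le> N \<Longrightarrow> u k * v i \<le> u i * v k"
  by (simp add: ratio_le_def)

lemma ratio_le_refl [simp]: "ratio_le N u u"
  by (simp add: ratio_le_def mult.commute)

lemma ratio_le_0 [simp]: "ratio_le 0 u v"
  by (simp add: ratio_le_def)

lemma ratio_le_trans:
  assumes uv: "ratio_le N u v" and vw: "ratio_le N v w"
    and pos: "\<And>i. v i > 0" and u: "\<And>i. u i \<ge> 0" and w: "\<And>i. w i \<ge> 0"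
  shows "ratio_le N u w"
  unfolding ratio_le_def
proof (intro allI impI)
  fix i k assume ik: "i \<le> k" "k \<le> N"
  have "(u k * w i) * (v i * v k) = (u k * v i) * (w i * v k)" by simp
  also have "\<dots> \<le> (u i * v k) * (w i * v k)"
    by (intro mult_right_mono ratio_leD[OF uv ik] mult_nonneg_nonneg w less_imp_le[OF pos])
  also have "\<dots> = (v k * w i) * (u i * v k)" by simp
  also have "\<dots> \<le> (v i * w k) * (u i * v k)"
    by (intro mult_right_mono ratio_leD[OF vw ik] mult_nonneg_nonneg u less_imp_le[OF pos])
  also have "\<dots> = (u i * w k) * (v i * v k)" by simp
  finally show "u k * w i \<le> u i * w k"
    using pos by (simp add: mult_le_cancel_right)
qed

lemma ratio_leI_Suc:
  assumes pos: "\<And>i. v i > 0" and u: "\<And>i. u i \<ge> 0"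
    and step: "\<And>m. m < N \<Longrightarrow> u (Suc m) * v m \<le> u m * v (Suc m)"
  shows "ratio_le N u v"
  unfolding ratio_le_def
proof (intro allI impI)
  fix i k :: nat assume "i \<le> k" "k \<le> N"
  hence "u k / v k \<le> u i / v i"
  proof (induction k rule: dec_induct)
    case (step m)
    have "u (Suc m) / v (Suc m) \<le> u m / v m"
      using assms(3)[of m] step.prems pos[of m] pos[of "Suc m"] by (simp add: field_simps)
    thus ?case using step by linarith
  qed simp
  thus "u k * v i \<le> u i * v k"
    using pos[of i] pos[of k] by (simp add: field_simps)
qed

lemma conv_nonneg:
  assumes "\<And>i. a i \<ge> 0" "\<And>i. v i \<ge> 0"
  shows "conv a v n \<ge> 0"
  unfolding conv_def by (intro sum_nonneg mult_nonneg_nonneg assms)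

lemma conv_pos:
  assumes "\<And>i. a i \<ge> 0" "\<And>i. v i \<ge> 0" "a n > 0" "v 0 > 0"
  shows "conv a v n > 0"
  unfolding conv_def
  by (rule sum_pos2[of _ n]) (use assms in auto)

lemma conv_alt: "conv a v n = (\<Sum>i\<le>n. v i * a (n - i))"
  unfolding conv_def by (rule sum.reindex_bij_witness[of _ "\<lambda>i. n - i" "\<lambda>i. n - i"]) auto

lemma conv_scale: "conv a (\<lambda>n. c * v n) = (\<lambda>n. c * conv a v n)"
  by (rule ext) (simp add: conv_def sum_distrib_left mult_ac)

lemma conv_Suc: "conv a v (Suc n) = a (Suc n) * v 0 + conv a (\<lambda>i. v (Suc i)) n"
  unfolding conv_def by (simp add: Suc_diff_le)

lemma conv_point:
  assumes "\<And>i. v (Suc i) = 0"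
  shows "conv a v n = v 0 * a n"
  by (cases n) (simp_all add: conv_Suc assms, simp_all add: conv_def assms)

lemma ratio_le_scale: "c \<ge> 0 \<Longrightarrow> ratio_le N u v \<Longrightarrow> ratio_le N u (\<lambda>n. c * v n)"
  unfolding ratio_le_def
  by (metis (no_types, lifting) mult.left_commute mult_left_mono)

lemma ratio_le_scale_left: "c \<ge> 0 \<Longrightarrow> ratio_le N u v \<Longrightarrow> ratio_le N (\<lambda>n. c * u n) v"
  unfolding ratio_le_def
  by (metis (no_types, lifting) mult.assoc mult_left_mono)

text \<open>
  The difference \<open>conv a u (m + 1) * V m - conv a u m * V (m + 1)\<close>, where \<open>V = conv a v\<close>, is a linear form
  \<open>\<Sum>i. u i * b i\<close> that vanishes for \<open>u = v\<close>. Since \<open>a\<close> is log-convex and its ratios are below those of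
  \<open>V\<close>, all coefficients \<open>b i\<close> but the last one are nonpositive. Replacing \<open>v\<close> by \<open>u\<close>, which favours large
  indices, therefore makes the form nonnegative.
\<close>

lemma conv_ratio_mono:
  assumes a: "\<And>i. a i > 0" and v: "\<And>i. v i > 0" and u: "\<And>i. u i \<ge> 0" "u 0 > 0"
    and convex: "\<And>i k. i \<le> k \<Longrightarrow> k < N \<Longrightarrow> a (Suc i) * a k \<le> a i * a (Suc k)"
    and av: "ratio_le N a (conv a v)" and vu: "ratio_le N v u"
  shows "ratio_le N (conv a v) (conv a u)"
proof (rule ratio_leI_Suc)
  show "conv a u i > 0" for i by (intro conv_pos less_imp_le a u)
  show Vnn: "conv a v i \<ge> 0" for i by (intro conv_nonneg less_imp_le a v)
  fix m assume m: "m < N"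
  define V where "V = conv a v"
  have Vpos: "V i > 0" for i unfolding V_def by (intro conv_pos less_imp_le a v)
  define b where "b i = a (Suc m - i) * V m - (if i \<le> m then a (m - i) else 0) * V (Suc m)" for i
  have sum_b: "(\<Sum>i\<le>Suc m. x i * b i) = conv a x (Suc m) * V m - conv a x m * V (Suc m)" for x
  proof -
    have "(\<Sum>i\<le>Suc m. x i * b i) =
        (\<Sum>i\<le>Suc m. x i * a (Suc m - i)) * V m
        - (\<Sum>i\<le>Suc m. if i \<le> m then x i * a (m - i) else 0) * V (Suc m)"
      unfolding sum_distrib_right sum_subtractf[symmetric]
      by (rule sum.cong) (auto simp: b_def algebra_simps)
    also have "(\<Sum>i\<le>Suc m. if i \<le> m then x i * a (m - i) else 0) = (\<Sum>i\<le>m. x i * a (m - i))"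
      by simp
    finally show ?thesis by (simp only: conv_alt)
  qed
  have b_neg: "b i \<le> 0" if "i \<le> m" for i
  proof -
    have "a (Suc (m - i)) * a m \<le> a (m - i) * a (Suc m)"
      using m by (intro convex) auto
    hence "(a (Suc (m - i)) * a m) * V m \<le> (a (m - i) * a (Suc m)) * V m"
      by (rule mult_right_mono) (use Vpos less_imp_le in auto)
    also have "\<dots> = a (m - i) * (a (Suc m) * V m)" by simp
    also have "\<dots> \<le> a (m - i) * (a m * V (Suc m))"
      using ratio_leD[OF av, of m "Suc m"] m a[of "m - i"] by (auto simp: V_def)
    finally have "a m * (a (Suc (m - i)) * V m) \<le> a m * (a (m - i) * V (Suc m))"
      by (simp add: mult_ac)
    hence "a (Suc (m - i)) * V m \<le> a (m - i) * V (Suc m)"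
      using a[of m] by simp
    thus ?thesis using that by (simp add: b_def Suc_diff_le)
  qed
  have zero: "(\<Sum>i\<le>Suc m. v i * b i) = 0"
    unfolding sum_b V_def by simp
  have "0 = u (Suc m) * (\<Sum>i\<le>Suc m. v i * b i)"
    using zero by simp
  also have "\<dots> = (\<Sum>i\<le>Suc m. (u (Suc m) * v i) * b i)"
    by (simp add: sum_distrib_left mult_ac del: sum.atMost_Suc)
  also have "\<dots> \<le> (\<Sum>i\<le>Suc m. (v (Suc m) * u i) * b i)"
  proof (rule sum_mono)
    fix i assume i: "i \<in> {..Suc m}"
    show "(u (Suc m) * v i) * b i \<le> (v (Suc m) * u i) * b i"
    proof (cases "i = Suc m")
      case False
      hence "i \<le> m" using i by auto
      moreover have "v (Suc m) * u i \<le> u (Suc m) * v i"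
        using ratio_leD[OF vu, of i "Suc m"] \<open>i \<le> m\<close> m by (simp add: mult.commute)
      ultimately show ?thesis using b_neg by (intro mult_right_mono_neg) auto
    qed (simp add: mult_ac)
  qed
  also have "\<dots> = v (Suc m) * (conv a u (Suc m) * V m - conv a u m * V (Suc m))"
    unfolding sum_b[symmetric] sum_distrib_left by (simp add: mult_ac del: sum.atMost_Suc)
  finally have "0 \<le> conv a u (Suc m) * V m - conv a u m * V (Suc m)"
    using v[of "Suc m"] by (simp add: zero_le_mult_iff)
  thus "conv a v (Suc m) * conv a u m \<le> conv a v m * conv a u (Suc m)"
    by (simp add: V_def mult.commute)
qed

section \<open>Generating functions of log-concave trees\<close>

text \<open>
  The coefficients of generating functions with \<open>G\<^sub>j = p j + z A\<^sup>d G\<^sub>j\<^sub>+\<^sub>1\<close> and \<open>A = G\<^sub>0\<close>, for a log-concave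
  \<open>p\<close>. The sequence \<open>C i j\<close> below consists of the coefficients of \<open>A\<^sup>i G\<^sub>j\<close>.
\<close>

locale series_recursion =
  fixes p :: "nat \<Rightarrow> real" and G :: "nat \<Rightarrow> nat \<Rightarrow> real" and d :: nat
  assumes d: "d \<ge> 1"
    and p0: "p 0 > 0" and p1: "p (Suc 0) > 0"
    and p_down: "\<And>j. p (Suc j) > 0 \<Longrightarrow> p j > 0"
    and p_concave: "\<And>j. p j * p (Suc (Suc j)) \<le> p (Suc j) * p (Suc j)"
    and G_0: "\<And>j. G j 0 = p j"
    and G_Suc: "\<And>j m. G j (Suc m) = (conv (G 0) ^^ d) (G (Suc j)) m"
    and G_nonneg: "\<And>j m. G j m \<ge> 0"
    and G_zero: "\<And>j m. p j = 0 \<Longrightarrow> G j m = 0"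
begin

abbreviation a :: "nat \<Rightarrow> real" where "a \<equiv> G 0"

abbreviation C :: "nat \<Rightarrow> nat \<Rightarrow> nat \<Rightarrow> real" where "C i j \<equiv> (conv a ^^ i) (G j)"

lemma p_nonneg: "p j \<ge> 0" using G_nonneg[of j 0] by (simp add: G_0)

lemma p_pos_iff: "p j > 0 \<longleftrightarrow> p j \<noteq> 0" using p_nonneg[of j] by auto

lemma C_nonneg: "C i j m \<ge> 0"
  by (induction i arbitrary: m) (auto intro: conv_nonneg G_nonneg)

lemma C_0_pos: "p j > 0 \<Longrightarrow> C i j 0 > 0"
  by (induction i) (auto simp: G_0 conv_def p0)

lemma a_pos: "a m > 0"
proof (induction m rule: less_induct)
  case (less m)
  show ?case
  proof (cases m)
    case (Suc k)
    obtain e where e: "d = Suc e" using d by (cases d) auto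
    have "a m = conv a (C e 1) k" by (simp add: Suc G_Suc e)
    also have "\<dots> > 0"
      using less Suc p1 by (intro conv_pos C_nonneg C_0_pos G_nonneg) auto
    finally show ?thesis .
  qed (simp add: G_0 p0)
qed

lemma C_Suc_pos: "p j > 0 \<Longrightarrow> C (Suc i) j m > 0"
  by (auto intro!: conv_pos C_nonneg C_0_pos G_nonneg a_pos)

lemma C_pos: "p j > 0 \<Longrightarrow> i \<ge> 1 \<Longrightarrow> C i j m > 0"
  using C_Suc_pos[of j "i - 1" m] by (cases i) auto

lemma G_pos: "p (Suc j) > 0 \<Longrightarrow> G j m > 0"
  using p_down[of j] C_pos[OF _ d, of "Suc j"] by (cases m) (auto simp: G_0 G_Suc)

text \<open>
  If \<open>p (j + 1) = 0\<close> then \<open>G\<^sub>j\<close> is the constant \<open>p j\<close>; this is the only way in which coefficients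
  vanish when \<open>p j > 0\<close>.
\<close>

lemma G_point: "p (Suc j) = 0 \<Longrightarrow> G j (Suc m) = 0"
proof -
  assume "p (Suc j) = 0"
  hence "G (Suc j) = (\<lambda>_. 0)" using G_zero by auto
  moreover have "(conv a ^^ i) (\<lambda>_. 0) = (\<lambda>_. 0)" for i
    by (induction i) (auto simp: conv_def)
  ultimately show ?thesis by (simp add: G_Suc)
qed

text \<open>
  The three assumptions are the induction hypothesis of \<open>ratio_bounds\<close>. What follows draws
  consequences at the same level \<open>N\<close>, and then moves on to level \<open>N + 1\<close>.
\<close>

context
  fixes N :: nat
  assumes G_decr: "\<And>j. p (Suc j) > 0 \<Longrightarrow> ratio_le N (G (Suc j)) (G j)"
    and a_le_C1: "\<And>j. p j > 0 \<Longrightarrow> ratio_le N a (C 1 j)"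
    and convex: "\<And>i k. i \<le> k \<Longrightarrow> k < N \<Longrightarrow> a (Suc i) * a k \<le> a i * a (Suc k)"
begin

lemma G_le_a: "p j > 0 \<Longrightarrow> ratio_le N (G j) a"
proof (induction j)
  case (Suc j)
  show ?case
    by (rule ratio_le_trans[OF G_decr[OF Suc.prems] Suc.IH[OF p_down[OF Suc.prems]]])
       (use Suc.prems G_pos G_nonneg in auto)
qed simp

lemma G_le_C1: "p j > 0 \<Longrightarrow> ratio_le N (G j) (C 1 j)"
  by (rule ratio_le_trans[OF G_le_a a_le_C1]) (auto intro: a_pos G_nonneg C_nonneg[of 1, simplified])

text \<open>
  The chain \<open>A \<le> A G\<^sub>j \<le> A\<^sup>2 G\<^sub>j \<le> \<dots>\<close>. Its first step is assumed; from \<open>G\<^sub>j \<le> A \<le> A G\<^sub>j\<close> each further step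
  arises by multiplication by \<open>A\<close>.
\<close>

lemma a_le_C: "p j > 0 \<Longrightarrow> i \<ge> 1 \<Longrightarrow> ratio_le N a (C i j)"
  and C_le_C_Suc: "p j > 0 \<Longrightarrow> i \<ge> 1 \<Longrightarrow> ratio_le N (C i j) (C (Suc i) j)"
proof -
  assume j: "p j > 0"
  have C12: "ratio_le N (C 1 j) (C 2 j)"
  proof (cases "p (Suc j) = 0")
    case True
    \<comment> \<open>Here \<open>G\<^sub>j\<close> is constant, and the claim is \<open>A \<le> A\<^sup>2\<close> up to factors, that is \<open>A \<le> A G\<^sub>0\<close>.\<close>
    have "C 1 j = (\<lambda>n. p j * a n)"
      using conv_point[of "G j" a] G_point[OF True] by (auto simp: G_0)
    hence "C 2 j = (\<lambda>n. p j * C 1 0 n)" "C 1 j = (\<lambda>n. p j * a n)"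
      by (simp_all add: numeral_2_eq_2 conv_scale)
    thus ?thesis
      using ratio_le_scale[OF _ ratio_le_scale_left[OF _ a_le_C1[OF p0]], of "p j" "p j"] j
      by simp
  next
    case False
    hence "p (Suc j) > 0" by (simp add: p_pos_iff)
    have "ratio_le N (conv a (G j)) (conv a (C 1 j))"
      by (rule conv_ratio_mono)
         (use j \<open>p (Suc j) > 0\<close> G_pos G_le_C1 a_le_C1 convex a_pos C_nonneg[of 1 j] C_0_pos[of j 1]
          in auto)
    thus ?thesis by (simp add: numeral_2_eq_2)
  qed
  assume "i \<ge> 1"
  hence "ratio_le N a (C i j) \<and> ratio_le N (C i j) (C (Suc i) j)"
  proof (induction i rule: dec_induct)
    case base
    show ?case using C12 a_le_C1[OF j] by (simp add: numeral_2_eq_2)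
  next
    case (step i)
    have *: "ratio_le N a (C (Suc i) j)"
      by (rule ratio_le_trans[of _ _ "C i j"])
         (use step C_pos[OF j] C_nonneg[of "Suc i" j] G_nonneg in auto)
    have "ratio_le N (conv a (C i j)) (conv a (C (Suc i) j))"
      by (rule conv_ratio_mono)
         (use j step * convex a_pos C_nonneg[of "Suc i" j] C_0_pos[of j "Suc i"] C_pos[OF j] in auto)
    with * show ?case by simp
  qed
  thus "ratio_le N a (C i j)" "ratio_le N (C i j) (C (Suc i) j)" by auto
qed

text \<open>
  Repeated multiplication by \<open>A\<close> preserves \<open>G\<^sub>j \<le> U\<close>. If \<open>G\<^sub>j\<close> is constant then it is below every
  sequence, and the first multiplication yields \<open>A \<le> A U\<close>, which has to be known beforehand.
\<close>

lemma C_ratio_mono: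
  assumes j: "p j > 0" and u: "\<And>i. u i \<ge> 0" "u 0 > 0"
    and le: "ratio_le N (G j) u" and au: "ratio_le N a (conv a u)"
  shows "ratio_le N (C i j) ((conv a ^^ i) u)"
proof (induction i)
  case (Suc i)
  have nn: "(conv a ^^ i) u m \<ge> 0" for m i
    by (induction i arbitrary: m) (auto intro: conv_nonneg G_nonneg u)
  have pos: "(conv a ^^ i) u 0 > 0"
    by (induction i) (auto simp: conv_def u G_0 p0)
  show ?case
  proof (cases "i = 0 \<and> p (Suc j) = 0")
    case True
    hence "C (Suc i) j = (\<lambda>n. p j * a n)"
      using conv_point[of "G j" a] G_point by (auto simp: G_0)
    thus ?thesis
      using ratio_le_scale_left[OF _ au, of "p j"] True j by simp
  next
    case False
    have "C i j m > 0" for m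
      using False G_pos[of j] C_pos[OF j, of i] by (cases i) (auto simp: p_pos_iff)
    moreover have "ratio_le N a (conv a (C i j))"
      using a_le_C[OF j, of "Suc i"] by simp
    ultimately have "ratio_le N (conv a (C i j)) (conv a ((conv a ^^ i) u))"
      using Suc.IH nn pos convex a_pos by (intro conv_ratio_mono) auto
    thus ?thesis by simp
  qed
qed (use le in simp)

text \<open>
  Log-convexity of \<open>a\<close> one step further: the shifted sequence \<open>a\<close> has generating function
  \<open>A\<^sup>d G\<^sub>1\<close>, and \<open>A \<le> A\<^sup>d G\<^sub>1\<close>.
\<close>

lemma convex_Suc: "i \<le> k \<Longrightarrow> k \<le> N \<Longrightarrow> a (Suc i) * a k \<le> a i * a (Suc k)"
  using ratio_leD[OF a_le_C[of "Suc 0" d], of i k] p1 d by (simp add: G_Suc mult.commute)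

text \<open>
  Beyond the constant term, \<open>G\<^sub>j\<^sub>+\<^sub>1\<close> and \<open>G\<^sub>j\<close> are the shifts of \<open>A\<^sup>d G\<^sub>j\<^sub>+\<^sub>2\<close> and \<open>A\<^sup>d G\<^sub>j\<^sub>+\<^sub>1\<close>, which are compared
  at level \<open>N\<close>. The comparison of the first two coefficients is the log-concavity of \<open>p\<close>.
\<close>

lemma G_decr_Suc:
  assumes j: "p (Suc j) > 0"
  shows "ratio_le (Suc N) (G (Suc j)) (G j)"
proof (rule ratio_leI_Suc)
  show "G j i > 0" for i by (rule G_pos[OF j])
  show "G (Suc j) i \<ge> 0" for i by (rule G_nonneg)
  fix m assume m: "m < Suc N"
  show "G (Suc j) (Suc m) * G j m \<le> G (Suc j) m * G j (Suc m)"
  proof (cases "p (Suc (Suc j)) = 0")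
    case True
    thus ?thesis using G_point[of "Suc j" m] G_nonneg by simp
  next
    case False
    hence j2: "p (Suc (Suc j)) > 0" by (simp add: p_pos_iff)
    show ?thesis
    proof (cases m)
      case 0
      have eq: "C i j 0 = a 0 ^ i * p j" for i j by (induction i) (auto simp: conv_def G_0)
      show ?thesis
        using mult_left_mono[OF p_concave[of j], of "p 0 ^ d"] p_nonneg[of 0]
        by (simp add: 0 G_0 G_Suc eq mult_ac)
    next
      case (Suc k)
      have "ratio_le N (C d (Suc (Suc j))) (C d (Suc j))"
        by (rule C_ratio_mono)
           (use j j2 G_decr a_le_C1 G_nonneg in \<open>auto simp: G_0\<close>)
      from ratio_leD[OF this, of k "Suc k"] show ?thesis
        using Suc m by (simp add: G_Suc)
    qed
  qed
qed

text \<open>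
  Split off the constant term of \<open>G\<^sub>j\<close>: \<open>A G\<^sub>j = p j A + z A (A\<^sup>d G\<^sub>j\<^sub>+\<^sub>1)\<close>. The first summand has the ratios
  of \<open>A\<close>, so it suffices to compare \<open>A\<close> with the second. After division by \<open>z\<close>, this is the comparison of
  \<open>A\<^sup>d G\<^sub>1\<close> with \<open>A\<^sup>d (A G\<^sub>j\<^sub>+\<^sub>1)\<close> at level \<open>N\<close>, which follows from \<open>G\<^sub>1 \<le> A \<le> A G\<^sub>j\<^sub>+\<^sub>1\<close>.
\<close>

lemma a_le_C1_Suc:
  assumes j: "p j > 0"
  shows "ratio_le (Suc N) a (C 1 j)"
proof (rule ratio_leI_Suc)
  show "C 1 j i > 0" for i using C_pos[OF j, of 1] by simp
  show "a i \<ge> 0" for i by (rule G_nonneg)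
  fix m assume m: "m < Suc N"
  show "a (Suc m) * C 1 j m \<le> a m * C 1 j (Suc m)"
  proof (cases "p (Suc j) = 0")
    case True
    thus ?thesis using conv_point[of "G j" a] G_point[of j] by simp
  next
    case False
    hence j1: "p (Suc j) > 0" by (simp add: p_pos_iff)
    have shift: "(\<lambda>i. G j (Suc i)) = C d (Suc j)" by (rule ext) (simp add: G_Suc)
    show ?thesis
    proof (cases m)
      case 0
      have "conv a (\<lambda>i. G j (Suc i)) 0 \<ge> 0" by (intro conv_nonneg G_nonneg)
      moreover have "C 1 j 0 = a 0 * p j" by (simp add: conv_def G_0)
      ultimately show ?thesis
        using G_nonneg[of 0 0] by (simp add: 0 conv_Suc distrib_left G_0)
    next
      case (Suc k)
      have "ratio_le N (G 1) (C 1 (Suc j))"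
        by (rule ratio_le_trans[OF G_le_a a_le_C1])
           (use p1 j1 a_pos G_nonneg C_nonneg[of 1 "Suc j"] in auto)
      moreover have "ratio_le N a (conv a (C 1 (Suc j)))"
        using a_le_C[OF j1, of 2] by (simp add: numeral_2_eq_2)
      ultimately have "ratio_le N (C d 1) ((conv a ^^ d) (C 1 (Suc j)))"
        by (intro C_ratio_mono)
           (use p1 C_nonneg[of 1 "Suc j"] C_0_pos[OF j1, of 1] in auto)
      also have "(conv a ^^ d) (C 1 (Suc j)) = conv a (C d (Suc j))"
        by (simp add: funpow_swap1)
      finally have "ratio_le N (C d 1) (conv a (C d (Suc j)))" .
      from ratio_leD[OF this, of k "Suc k"]
      have "a (Suc m) * conv a (C d (Suc j)) k \<le> a m * conv a (C d (Suc j)) m"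
        using Suc m by (simp add: G_Suc)
      thus ?thesis
        by (simp add: Suc conv_Suc shift algebra_simps)
    qed
  qed
qed

end

lemma ratio_bounds:
  "(\<forall>j. p (Suc j) > 0 \<longrightarrow> ratio_le N (G (Suc j)) (G j)) \<and>
   (\<forall>j. p j > 0 \<longrightarrow> ratio_le N a (C 1 j)) \<and>
   (\<forall>i k. i \<le> k \<longrightarrow> k < N \<longrightarrow> a (Suc i) * a k \<le> a i * a (Suc k))"
proof (induction N)
  case (Suc N)
  hence IH: "\<And>j. p (Suc j) > 0 \<Longrightarrow> ratio_le N (G (Suc j)) (G j)"
    "\<And>j. p j > 0 \<Longrightarrow> ratio_le N a (C 1 j)"
    "\<And>i k. i \<le> k \<Longrightarrow> k < N \<Longrightarrow> a (Suc i) * a k \<le> a i * a (Suc k)"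
    by blast+
  show ?case
    using G_decr_Suc[OF IH] a_le_C1_Suc[OF IH] convex_Suc[OF IH] by (simp add: less_Suc_eq_le)
qed simp

lemma G_ratio_decr: "p (Suc j) > 0 \<Longrightarrow> ratio_le N (G (Suc j)) (G j)"
  and a_ratio_le_C1: "p j > 0 \<Longrightarrow> ratio_le N a (C 1 j)"
  and a_ratio_convex: "i \<le> k \<Longrightarrow> k < N \<Longrightarrow> a (Suc i) * a k \<le> a i * a (Suc k)"
  using ratio_bounds[of N] by blast+

lemma ratio_a_le_C: "p j > 0 \<Longrightarrow> i \<ge> 1 \<Longrightarrow> ratio_le N a (C i j)"
  by (rule a_le_C[OF G_ratio_decr a_ratio_le_C1 a_ratio_convex])

lemma ratio_C_mono:
  assumes "p j > 0" "i \<le> i'"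
  shows "ratio_le N (C i j) (C i' j)"
  using \<open>i \<le> i'\<close>
proof (induction i' rule: dec_induct)
  case (step n)
  show ?case
  proof (cases "n = 0")
    case True
    thus ?thesis
      using G_le_C1[OF G_ratio_decr a_ratio_le_C1 a_ratio_convex assms(1)] step by simp
  next
    case False
    hence n: "n \<ge> 1" by simp
    have "ratio_le N (C n j) (C (Suc n) j)"
      by (rule C_le_C_Suc[OF G_ratio_decr a_ratio_le_C1 a_ratio_convex assms(1) n])
    thus ?thesis
      by (rule ratio_le_trans[OF step.IH]) (rule C_pos[OF assms(1) n] C_nonneg)+
  qed
qed simp

lemma ratio_Cd_decr: "p (Suc j) > 0 \<Longrightarrow> ratio_le N (C d (Suc j)) (C d 1)"
proof (induction j)
  case (Suc j)
  have j: "p (Suc j) > 0" using p_down Suc.prems by blast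
  have a_le: "ratio_le N a (conv a (G (Suc j)))"
    using a_ratio_le_C1[OF j] by simp
  have "ratio_le N (C d (Suc (Suc j))) (C d (Suc j))"
    by (rule C_ratio_mono[OF G_ratio_decr a_ratio_le_C1 a_ratio_convex Suc.prems])
       (use j a_le G_ratio_decr[OF Suc.prems] G_nonneg in \<open>simp_all add: G_0\<close>)
  thus ?case
    by (rule ratio_le_trans[OF _ Suc.IH[OF j]]) (rule C_pos[OF j d] C_nonneg)+
qed simp

text \<open>
  Log-convexity of \<open>W = A\<^sup>i G\<^sub>j\<^sub>+\<^sub>1\<close>, from the chain \<open>W \<le> A\<^sup>d G\<^sub>j\<^sub>+\<^sub>1 \<le> A\<^sup>d G\<^sub>1\<close>: the last series is the shift of
  \<open>A\<close>, and since \<open>A \<le> W\<close>, it is below the shift of \<open>W\<close>.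
\<close>

lemma C_ratio_convex:
  assumes j: "p (Suc j) > 0" and i: "1 \<le> i" "i \<le> d"
  shows "ratio_le N (C i (Suc j)) (\<lambda>n. C i (Suc j) (Suc n))"
proof -
  have shift: "(\<lambda>n. a (Suc n)) = C d 1" by (rule ext) (simp add: G_Suc)
  have le: "ratio_le N (C i (Suc j)) (C d 1)"
    by (rule ratio_le_trans[OF ratio_C_mono[OF j i(2)] ratio_Cd_decr[OF j]])
       (rule C_pos[OF j d] C_nonneg)+
  have "ratio_le N (\<lambda>n. a (Suc n)) (\<lambda>n. C i (Suc j) (Suc n))"
    using ratio_a_le_C[OF j i(1), of "Suc N"] unfolding ratio_le_def by auto
  thus ?thesis
    unfolding shift by (rule ratio_le_trans[OF le]) (use C_pos[OF _ d] p1 C_nonneg in auto)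
qed

text \<open>
  The bound needed for the coupling of sizes, with \<open>u\<close> one of the two factors of \<open>W = A\<^sup>i G\<^sub>j\<^sub>+\<^sub>1\<close>: the ratio
  of \<open>u\<close> at \<open>y\<close> is below that of \<open>W\<close> at \<open>y\<close>, which is below that of \<open>W\<close> at \<open>m \<ge> y\<close> by log-convexity.
\<close>

lemma step_ratio:
  assumes j: "p (Suc j) > 0" and i: "1 \<le> i" "i \<le> d" and u: "ratio_le (Suc m) u (C i (Suc j))"
    and u0: "\<And>n. u n \<ge> 0" and y: "y \<le> m"
  shows "u (Suc y) * C i (Suc j) m \<le> u y * C i (Suc j) (Suc m)"
proof -
  let ?W = "C i (Suc j)"
  have W: "?W n > 0" for n by (rule C_pos[OF j i(1)])
  have "(u (Suc y) * ?W m) * ?W y = (u (Suc y) * ?W y) * ?W m" by simp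
  also have "\<dots> \<le> (u y * ?W (Suc y)) * ?W m"
    using ratio_leD[OF u, of y "Suc y"] y W[of m] by (intro mult_right_mono) auto
  also have "\<dots> = u y * (?W m * ?W (Suc y))" by simp
  also have "\<dots> \<le> u y * (?W y * ?W (Suc m))"
    using ratio_leD[OF C_ratio_convex[OF j i], of y m] y by (intro mult_left_mono u0) auto
  also have "\<dots> = (u y * ?W (Suc m)) * ?W y" by simp
  finally show ?thesis using W[of y] by simp
qed

end

section \<open>Plane forests as binary trees\<close>

text \<open>
  The classical encoding of plane forests: in \<open>Branch f g\<close>, the first tree of the forest is a root with
  the forest \<open>f\<close> above it, and \<open>g\<close> consists of the other trees. This makes the decomposition into the
  first tree and the rest available by structural recursion.
\<close>

datatype forest = Void | Branch forest forest

primrec fsize :: "forest \<Rightarrow> nat" where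
  "fsize Void = 0"
| "fsize (Branch f g) = Suc (fsize f + fsize g)"

text \<open>
  The vertices of a forest as words: the trees of a forest are numbered from 1, so the trees of the
  remaining forest are renumbered. Adding the empty word gives the plane tree whose root carries the
  forest.
\<close>

primrec vertices :: "forest \<Rightarrow> nat list set" where
  "vertices Void = {}"
| "vertices (Branch f g) =
     (#) 1 ` insert [] (vertices f) \<union> {Suc i # v | i v. i # v \<in> vertices g}"

text \<open>
  The weight of a forest attached to a vertex that has already \<open>s\<close> other children on the left. The
  number of children of that vertex is only known at the end of the list of trees, where \<open>Void\<close>
  contributes its factor.
\<close>

primrec fweight :: "nat pmf \<Rightarrow> forest \<Rightarrow> nat \<Rightarrow> real" where
  "fweight \<mu> Void s = pmf \<mu> s"
| "fweight \<mu> (Branch f g) s = fweight \<mu> f 0 * fweight \<mu> g (Suc s)"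

definition fmass :: "nat pmf \<Rightarrow> nat \<Rightarrow> nat \<Rightarrow> real" where
  "fmass \<mu> s N = (\<Sum>f | fsize f = N. fweight \<mu> f s)"

definition plane_forest :: "nat list set \<Rightarrow> bool" where
  "plane_forest F \<longleftrightarrow> finite F \<and> [] \<notin> F \<and> F \<subseteq> ulam_harris \<and>
     (\<forall>u i. u @ [i] \<in> F \<longrightarrow> (u = [] \<or> u \<in> F) \<and> (\<forall>j\<in>{1..i}. u @ [j] \<in> F))"

lemma plane_forest_closed:
  assumes "plane_forest F" "u @ [i] \<in> F"
  shows "u = [] \<or> u \<in> F" "1 \<le> j \<Longrightarrow> j \<le> i \<Longrightarrow> u @ [j] \<in> F"
proof -
  have "\<forall>u i. u @ [i] \<in> F \<longrightarrow> (u = [] \<or> u \<in> F) \<and> (\<forall>j\<in>{1..i}. u @ [j] \<in> F)"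
    using assms(1) unfolding plane_forest_def by (elim conjE)
  hence *: "(u = [] \<or> u \<in> F) \<and> (\<forall>j\<in>{1..i}. u @ [j] \<in> F)"
    using assms(2) by (elim allE impE)
  show "u = [] \<or> u \<in> F" by (rule conjunct1[OF *])
  show "u @ [j] \<in> F" if "1 \<le> j" "j \<le> i"
    using bspec[OF conjunct2[OF *], of j] that by simp
qed

lemma plane_forestD:
  assumes "plane_forest F"
  shows "finite F" "[] \<notin> F" "F \<subseteq> ulam_harris" "0 # v \<notin> F"
proof -
  show F: "finite F" "[] \<notin> F" "F \<subseteq> ulam_harris"
    using assms unfolding plane_forest_def by blast+
  show "0 # v \<notin> F" using F(3) by (auto simp: ulam_harris_def)
qed

lemma Nil_in_plane_tree: "T \<in> plane_trees \<Longrightarrow> [] \<in> T"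
  using take_mem_plane_tree[of T _ 0] by (auto simp: plane_trees_def)

lemma plane_forest_imp_tree: "plane_forest F \<Longrightarrow> insert [] F \<in> plane_trees"
  unfolding plane_forest_def plane_trees_def mem_Collect_eq
  by (intro conjI) (simp_all add: ulam_harris_def)

lemma plane_tree_imp_forest:
  assumes T: "T \<in> plane_trees"
  shows "plane_forest (T - {[]})"
proof -
  have closed: "u \<in> T \<and> (\<forall>j\<in>{1..i}. u @ [j] \<in> T)" if "u @ [i] \<in> T" for u i
  proof -
    have "u @ [i] \<in> ulam_harris" using T that by (auto simp: plane_trees_def)
    hence "u \<in> ulam_harris" "i \<ge> 1" by (auto simp: ulam_harris_def)
    thus ?thesis using T that unfolding plane_trees_def by blast
  qed
  have "\<forall>u i. u @ [i] \<in> T - {[]} \<longrightarrow>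
      (u = [] \<or> u \<in> T - {[]}) \<and> (\<forall>j\<in>{1..i}. u @ [j] \<in> T - {[]})"
  proof (intro allI impI)
    fix u i assume "u @ [i] \<in> T - {[]}"
    hence "u @ [i] \<in> T" by (rule DiffD1)
    from closed[OF this]
    show "(u = [] \<or> u \<in> T - {[]}) \<and> (\<forall>j\<in>{1..i}. u @ [j] \<in> T - {[]})" by simp
  qed
  moreover have "finite T" "T \<subseteq> ulam_harris"
    using T unfolding plane_trees_def by blast+
  ultimately show ?thesis unfolding plane_forest_def by blast
qed

lemma plane_forest_first:
  assumes "plane_forest F" "F \<noteq> {}"
  shows "[1] \<in> F"
proof -
  obtain u where u: "u \<in> F" using assms(2) by blast
  then obtain i v where iv: "u = i # v"
    using plane_forestD(2)[OF assms(1)] by (cases u) auto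
  have "take 1 u \<in> insert [] F"
    using take_mem_plane_tree[OF plane_forest_imp_tree[OF assms(1)], of u 1] u by blast
  hence i: "[] @ [i] \<in> F" by (auto simp: iv)
  moreover have "i \<ge> 1" using i plane_forestD(4)[OF assms(1), of "[]"] by (cases i) auto
  ultimately show ?thesis using plane_forest_closed(2)[OF assms(1) i, of 1] by simp
qed

lemma Cons_mem_vertices_Branch:
  "i # v \<in> vertices (Branch f g) \<longleftrightarrow>
     (i = 1 \<and> (v = [] \<or> v \<in> vertices f)) \<or> (\<exists>k. i = Suc k \<and> k # v \<in> vertices g)"
  by auto

lemma shift_image:
  assumes "[] \<notin> V"
  shows "{Suc i # v | i v. i # v \<in> V} = (\<lambda>u. Suc (hd u) # tl u) ` V"
proof (intro equalityI subsetI)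
  fix u assume "u \<in> (\<lambda>u. Suc (hd u) # tl u) ` V"
  then obtain w where w: "w \<in> V" "u = Suc (hd w) # tl w" by auto
  hence "hd w # tl w \<in> V" using assms by (cases w) auto
  thus "u \<in> {Suc i # v | i v. i # v \<in> V}" using w by blast
next
  fix u assume "u \<in> {Suc i # v | i v. i # v \<in> V}"
  then obtain i v where "u = Suc i # v" "i # v \<in> V" by blast
  thus "u \<in> (\<lambda>u. Suc (hd u) # tl u) ` V" by (intro image_eqI[of _ _ "i # v"]) auto
qed

lemma plane_forest_vertices: "plane_forest (vertices f)"
proof (induction f)
  case (Branch f g)
  have "{Suc i # v | i v. i # v \<in> vertices g} = (\<lambda>u. Suc (hd u) # tl u) ` vertices g"
    by (rule shift_image[OF plane_forestD(2)[OF Branch.IH(2)]])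
  hence fin: "finite (vertices (Branch f g))"
    using plane_forestD(1)[OF Branch.IH(1)] plane_forestD(1)[OF Branch.IH(2)] by simp
  have UH: "vertices (Branch f g) \<subseteq> ulam_harris"
  proof
    fix u assume "u \<in> vertices (Branch f g)"
    then consider "u = [1]" | v where "u = 1 # v" "v \<in> vertices f"
      | i v where "u = Suc i # v" "i # v \<in> vertices g"
      by auto
    thus "u \<in> ulam_harris"
      using plane_forestD(3)[OF Branch.IH(1)] plane_forestD(3)[OF Branch.IH(2)]
      by cases (auto simp: ulam_harris_def subset_iff)
  qed
  have closed: "(u = [] \<or> u \<in> vertices (Branch f g)) \<and>
      (\<forall>j\<in>{1..i}. u @ [j] \<in> vertices (Branch f g))" if u: "u @ [i] \<in> vertices (Branch f g)" for u i
  proof (cases u)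
    case Nil
    have "[j] \<in> vertices (Branch f g)" if j: "1 \<le> j" "j \<le> i" for j
    proof (cases "j = 1")
      case False
      then obtain k where k: "j = Suc k" "k \<ge> 1" using j by (cases j) auto
      then obtain l where l: "i = Suc l" "k \<le> l" using j by (cases i) auto
      have "[] @ [l] \<in> vertices g" using u Nil k l by auto
      hence "[] @ [k] \<in> vertices g"
        using plane_forest_closed(2)[OF Branch.IH(2)] k l by blast
      thus ?thesis by (auto simp: k)
    qed auto
    thus ?thesis using Nil by (simp del: vertices.simps)
  next
    case (Cons k w)
    from u Cons consider "k = 1" "w @ [i] \<in> vertices f"
      | l where "k = Suc l" "(l # w) @ [i] \<in> vertices g"
      by auto
    thus ?thesis
    proof cases
      case 1
      thus ?thesis
        using plane_forest_closed[OF Branch.IH(1) 1(2)] Cons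
        by (simp add: Cons_mem_vertices_Branch del: vertices.simps)
    next
      case (2 l)
      thus ?thesis
        using plane_forest_closed[OF Branch.IH(2) 2(2)] Cons
        by (simp add: Cons_mem_vertices_Branch del: vertices.simps)
    qed
  qed
  have "\<forall>u i. u @ [i] \<in> vertices (Branch f g) \<longrightarrow>
      (u = [] \<or> u \<in> vertices (Branch f g)) \<and> (\<forall>j\<in>{1..i}. u @ [j] \<in> vertices (Branch f g))"
    by (intro allI impI closed)
  moreover have "[] \<notin> vertices (Branch f g)" by auto
  ultimately show ?case
    unfolding plane_forest_def by (intro conjI[OF fin conjI[OF _ conjI[OF UH]]])
qed (simp add: plane_forest_def)

lemma vertices_props [simp]:
  "finite (vertices f)" "[] \<notin> vertices f" "0 # v \<notin> vertices f"
  by (rule plane_forestD[OF plane_forest_vertices])+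

lemma vertices_Branch_image:
  "vertices (Branch f g) = (#) 1 ` insert [] (vertices f) \<union> (\<lambda>u. Suc (hd u) # tl u) ` vertices g"
  unfolding vertices.simps shift_image[OF vertices_props(2)] ..

lemma inj_on_shift: "inj_on (\<lambda>u. Suc (hd u) # tl u) (vertices f)"
proof (rule inj_onI)
  fix u v assume "u \<in> vertices f" "v \<in> vertices f" "Suc (hd u) # tl u = Suc (hd v) # tl v"
  thus "u = v" by (cases u; cases v) auto
qed

lemma Branch_disjoint:
  "(#) 1 ` A \<inter> (\<lambda>u. Suc (hd u) # tl u) ` vertices g = {}"
proof -
  have "hd u \<noteq> 0" if "u \<in> vertices g" for u
    using that by (cases u; cases "hd u") auto
  hence "1 # v \<noteq> Suc (hd u) # tl u" if "u \<in> vertices g" for u v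
    using that by simp
  thus ?thesis by blast
qed

lemma card_vertices: "card (vertices f) = fsize f"
proof (induction f)
  case (Branch f g)
  have "card ((#) 1 ` insert [] (vertices f)) = Suc (fsize f)"
    using Branch.IH(1) by (subst card_image) auto
  moreover have "card ((\<lambda>u. Suc (hd u) # tl u) ` vertices g) = fsize g"
    using Branch.IH(2) by (simp add: card_image inj_on_shift)
  ultimately show ?case
    unfolding vertices_Branch_image
    by (subst card_Un_disjoint[OF _ _ Branch_disjoint]) auto
qed simp

lemma vertices_Branch_mono:
  "vertices f \<subseteq> vertices f' \<Longrightarrow> vertices g \<subseteq> vertices g' \<Longrightarrow>
   vertices (Branch f g) \<subseteq> vertices (Branch f' g')"
  unfolding vertices.simps by (intro Un_mono image_mono insert_mono Collect_mono) blast+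

lemma vertices_inj: "vertices f = vertices f' \<Longrightarrow> f = f'"
proof (induction f arbitrary: f')
  case Void
  thus ?case by (cases f') auto
next
  case (Branch f g)
  then obtain h k where f': "f' = Branch h k" by (cases f') auto
  have eq: "i # v \<in> vertices (Branch f g) \<longleftrightarrow> i # v \<in> vertices (Branch h k)" for i v
    by (simp only: Branch.prems f')
  have "v \<in> vertices f \<longleftrightarrow> v \<in> vertices h" for v
    using eq[of 1 v] by (cases v) (auto simp: Cons_mem_vertices_Branch simp del: vertices.simps)
  hence "vertices f = vertices h" by auto
  moreover have "v \<in> vertices g \<longleftrightarrow> v \<in> vertices k" for v
  proof (cases v)
    case (Cons i w)
    show ?thesis
    proof (cases i)
      case (Suc n)
      thus ?thesis using eq[of "Suc i" w]
        by (auto simp: Cons_mem_vertices_Branch Cons simp del: vertices.simps)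
    qed (simp add: Cons)
  qed simp
  hence "vertices g = vertices k" by auto
  ultimately show ?case using Branch.IH f' by auto
qed

text \<open>
  By induction on the number of vertices: the words that start with 1 yield the forest above the first
  root, and the other words, renumbered, yield the remaining trees.
\<close>

lemma vertices_surj: "plane_forest F \<Longrightarrow> \<exists>f. vertices f = F"
proof (induction "card F" arbitrary: F rule: less_induct)
  case less
  note closed = plane_forest_closed[OF less.prems]
  show ?case
  proof (cases "F = {}")
    case True
    thus ?thesis by (intro exI[of _ Void]) simp
  next
    case False
    have one: "[1] \<in> F" by (rule plane_forest_first[OF less.prems False])
    have fin: "finite F" and UH: "F \<subseteq> ulam_harris" and Nil: "[] \<notin> F"
      by (rule plane_forestD[OF less.prems])+
    have zero: "0 # v \<notin> F" for v by (rule plane_forestD(4)[OF less.prems])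
    \<comment> \<open>\<open>A\<close> is the forest above the first root, \<open>B\<close> the forest of the other trees.\<close>
    define A where "A = {v. v \<noteq> [] \<and> 1 # v \<in> F}"
    define B where "B = {v. v \<noteq> [] \<and> hd v \<ge> 1 \<and> Suc (hd v) # tl v \<in> F}"
    have less_card: "card (F - {[1]}) < card F"
      using one fin by (metis card_Diff1_less)
    have A_inj: "inj_on ((#) 1) A" "(#) 1 ` A \<subseteq> F - {[1]}" by (auto simp: A_def)
    have B_inj: "inj_on (\<lambda>v. Suc (hd v) # tl v) B" "(\<lambda>v. Suc (hd v) # tl v) ` B \<subseteq> F - {[1]}"
      by (auto simp: B_def inj_on_def intro: list.expand)
    have finA: "finite A" "card A < card F"
      using inj_on_finite[OF A_inj] card_inj_on_le[OF A_inj] fin less_card by auto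
    have finB: "finite B" "card B < card F"
      using inj_on_finite[OF B_inj] card_inj_on_le[OF B_inj] fin less_card by auto
    have "plane_forest A"
      unfolding plane_forest_def
    proof (intro conjI allI impI ballI)
      show "A \<subseteq> ulam_harris" using UH by (auto simp: A_def ulam_harris_def)
      fix u i assume "u @ [i] \<in> A"
      hence *: "(1 # u) @ [i] \<in> F" by (simp add: A_def)
      show "u = [] \<or> u \<in> A" using closed(1)[OF *] by (auto simp: A_def)
      fix j assume "j \<in> {1..i}"
      thus "u @ [j] \<in> A" using closed(2)[OF *, of j] by (auto simp: A_def)
    qed (use finA in \<open>auto simp: A_def\<close>)
    then obtain f where f: "vertices f = A" using less.hyps finA by blast
    have "plane_forest B"
      unfolding plane_forest_def
    proof (intro conjI allI impI ballI)
      show "B \<subseteq> ulam_harris"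
      proof
        fix u assume "u \<in> B"
        then obtain i v where "u = i # v" "i \<ge> 1" "Suc i # v \<in> F" by (cases u) (auto simp: B_def)
        thus "u \<in> ulam_harris" using UH by (auto simp: ulam_harris_def)
      qed
      fix u i assume u: "u @ [i] \<in> B"
      show "u = [] \<or> u \<in> B"
        using u closed(1)[of "Suc (hd u) # tl u" i] by (cases u) (auto simp: B_def)
      fix j assume "j \<in> {1..i}"
      thus "u @ [j] \<in> B"
        using u closed(2)[of "Suc (hd u) # tl u" i j] closed(2)[of "[]" "Suc i" "Suc j"]
        by (cases u) (auto simp: B_def)
    qed (use finB in \<open>auto simp: B_def\<close>)
    then obtain g where g: "vertices g = B" using less.hyps finB by blast
    have "u \<in> vertices (Branch f g) \<longleftrightarrow> u \<in> F" for u
    proof (cases u)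
      case (Cons i v)
      show ?thesis
      proof (cases "i \<le> 1")
        case True
        hence "i = 0 \<or> i = 1" by auto
        thus ?thesis using one zero
          by (auto simp: Cons Cons_mem_vertices_Branch f g A_def B_def simp del: vertices.simps)
      next
        case False
        then obtain k where "i = Suc k" "k \<ge> 1" by (cases i) auto
        thus ?thesis
          by (auto simp: Cons Cons_mem_vertices_Branch f g A_def B_def simp del: vertices.simps)
      qed
    qed (use Nil in auto)
    thus ?thesis by blast
  qed
qed

primrec roots :: "forest \<Rightarrow> nat" where
  "roots Void = 0"
| "roots (Branch f g) = Suc (roots g)"

lemma num_children_root: "num_children (vertices f) [] = roots f"
proof -
  have root: "[i] \<in> vertices f \<longleftrightarrow> 1 \<le> i \<and> i \<le> roots f" for i
  proof (induction f arbitrary: i)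
    case (Branch f g)
    show ?case
      by (cases i) (auto simp: Cons_mem_vertices_Branch Branch.IH(2) simp del: vertices.simps)
  qed simp
  have "{i. i \<ge> 1 \<and> [] @ [i] \<in> vertices f} = {1..roots f}"
    unfolding append_Nil root by auto
  thus ?thesis by (simp add: num_children_def)
qed

lemma num_children_insert_root: "num_children (insert [] S) u = num_children S u"
  by (simp add: num_children_def)

lemma num_children_first:
  "num_children (vertices (Branch f g)) (1 # v) = num_children (vertices f) v"
  by (simp add: num_children_def Cons_mem_vertices_Branch del: vertices.simps)

lemma num_children_rest:
  "u \<in> vertices g \<Longrightarrow>
     num_children (vertices (Branch f g)) (Suc (hd u) # tl u) = num_children (vertices g) u"
proof (cases u)
  case (Cons i v)
  assume "u \<in> vertices g"
  hence "i \<noteq> 0" using Cons vertices_props(3)[of v g] by (intro notI) simp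
  thus ?thesis
    by (simp add: Cons num_children_def Cons_mem_vertices_Branch del: vertices.simps)
qed simp

lemma fweight_eq_prod:
  "fweight \<mu> f s = pmf \<mu> (s + roots f) * (\<Prod>u\<in>vertices f. pmf \<mu> (num_children (vertices f) u))"
proof (induction f arbitrary: s)
  case (Branch f g)
  let ?n = "num_children (vertices (Branch f g))"
  have "(\<Prod>u\<in>vertices (Branch f g). pmf \<mu> (?n u)) =
      (\<Prod>u\<in>(#) 1 ` insert [] (vertices f). pmf \<mu> (?n u)) *
      (\<Prod>u\<in>(\<lambda>u. Suc (hd u) # tl u) ` vertices g. pmf \<mu> (?n u))"
    by (subst (1) vertices_Branch_image, rule prod.union_disjoint[OF _ _ Branch_disjoint])
       (simp_all del: vertices.simps)
  also have "(\<Prod>u\<in>(#) 1 ` insert [] (vertices f). pmf \<mu> (?n u)) = fweight \<mu> f 0"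
    by (subst prod.reindex)
       (auto simp add: Branch.IH num_children_first num_children_root
             simp del: vertices.simps image_insert One_nat_def)
  also have "(\<Prod>u\<in>(\<lambda>u. Suc (hd u) # tl u) ` vertices g. pmf \<mu> (?n u)) =
      (\<Prod>u\<in>vertices g. pmf \<mu> (num_children (vertices g) u))"
    unfolding prod.reindex[OF inj_on_shift] o_def
    by (intro prod.cong refl) (simp only: num_children_rest)
  finally show ?case by (simp add: Branch.IH)
qed simp

lemma bgw_weight_tree: "bgw_weight \<mu> (insert [] (vertices f)) = fweight \<mu> f 0"
  by (simp add: bgw_weight_def num_children_insert_root num_children_root fweight_eq_prod)

lemma bij_betw_tree:
  "bij_betw (\<lambda>f. insert [] (vertices f)) {f. fsize f = N} (plane_trees_of_size (Suc N))"
proof (rule bij_betwI')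
  fix f g
  have "insert [] (vertices f) = insert [] (vertices g) \<Longrightarrow> vertices f = vertices g"
    by (rule insert_ident[THEN iffD1, rotated 2]) auto
  thus "(insert [] (vertices f) = insert [] (vertices g)) = (f = g)"
    using vertices_inj[of f g] by blast
next
  fix f assume "f \<in> {f. fsize f = N}"
  thus "insert [] (vertices f) \<in> plane_trees_of_size (Suc N)"
    using plane_forest_imp_tree[OF plane_forest_vertices]
    by (simp add: plane_trees_of_size_def card_vertices)
next
  fix T assume "T \<in> plane_trees_of_size (Suc N)"
  hence T: "T \<in> plane_trees" "card T = Suc N" "[] \<in> T"
    by (auto simp: plane_trees_of_size_def Nil_in_plane_tree)
  obtain f where f: "vertices f = T - {[]}"
    using vertices_surj[OF plane_tree_imp_forest[OF T(1)]] by blast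
  have "T = insert [] (vertices f)" using f T(3) by blast
  moreover have "fsize f = N" using T(2,3) by (simp add: card_vertices[symmetric] f)
  ultimately show "\<exists>f\<in>{f. fsize f = N}. T = insert [] (vertices f)" by blast
qed

lemma finite_fsize: "finite {f. fsize f = N}"
  using bij_betw_finite[OF bij_betw_tree] finite_plane_trees_of_size by blast

lemma bgw_mass_eq: "bgw_mass \<mu> (Suc N) = fmass \<mu> 0 N"
  unfolding bgw_mass_def fmass_def
  using sum.reindex_bij_betw[OF bij_betw_tree, of "bgw_weight \<mu>" N]
  by (simp add: bgw_weight_tree)

lemma fweight_nonneg: "fweight \<mu> f s \<ge> 0"
  by (induction f arbitrary: s) auto

lemma fmass_nonneg: "fmass \<mu> s N \<ge> 0"
  unfolding fmass_def by (intro sum_nonneg fweight_nonneg)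

lemma fmass_0: "fmass \<mu> s 0 = pmf \<mu> s"
proof -
  have "fsize f = 0 \<longleftrightarrow> f = Void" for f by (cases f) auto
  thus ?thesis by (simp add: fmass_def)
qed

text \<open>
  Decomposition of a nonempty forest, according to the size of the forest above its first root.
\<close>

lemma fmass_Suc: "fmass \<mu> s (Suc N) = (\<Sum>x\<le>N. fmass \<mu> 0 x * fmass \<mu> (Suc s) (N - x))"
proof -
  let ?A = "\<lambda>N. {f. fsize f = N}"
  let ?S = "SIGMA x:{..N}. ?A x \<times> ?A (N - x)"
  have "h \<in> (\<lambda>(x, f, g). Branch f g) ` ?S" if "fsize h = Suc N" for h
  proof (cases h)
    case (Branch f g)
    hence "h = (\<lambda>(x, f, g). Branch f g) (fsize f, f, g)" "(fsize f, f, g) \<in> ?S"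
      using that by auto
    thus ?thesis by (rule image_eqI)
  qed (use that in simp)
  hence image: "?A (Suc N) = (\<lambda>(x, f, g). Branch f g) ` ?S" by auto
  have inj: "inj_on (\<lambda>(x, f, g). Branch f g) ?S" by (auto simp: inj_on_def)
  have "fmass \<mu> s (Suc N) = (\<Sum>(x, f, g)\<in>?S. fweight \<mu> f 0 * fweight \<mu> g (Suc s))"
    unfolding fmass_def image sum.reindex[OF inj] by (intro sum.cong) auto
  also have "\<dots> = (\<Sum>x\<le>N. \<Sum>(f, g)\<in>?A x \<times> ?A (N - x). fweight \<mu> f 0 * fweight \<mu> g (Suc s))"
    by (subst sum.Sigma) (auto simp: finite_fsize)
  also have "\<dots> = (\<Sum>x\<le>N. fmass \<mu> 0 x * fmass \<mu> (Suc s) (N - x))"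
    by (simp add: fmass_def sum_product sum.cartesian_product)
  finally show ?thesis .
qed

section \<open>Couplings with unit steps\<close>

definition normalized_pmf :: "'a set \<Rightarrow> ('a \<Rightarrow> real) \<Rightarrow> 'a pmf" where
  "normalized_pmf A w = embed_pmf (\<lambda>x. if x \<in> A then w x / sum w A else 0)"

lemma pmf_normalized:
  assumes "finite A" "\<And>x. w x \<ge> 0" "sum w A > 0"
  shows "pmf (normalized_pmf A w) x = (if x \<in> A then w x / sum w A else 0)"
  unfolding normalized_pmf_def
proof (rule pmf_embed_pmf)
  show "0 \<le> (if x \<in> A then w x / sum w A else 0)" for x
    using assms by (simp add: less_imp_le)
  have "(\<integral>\<^sup>+ x. ennreal (if x \<in> A then w x / sum w A else 0) \<partial>count_space UNIV) =
      (\<Sum>x\<in>A. ennreal (if x \<in> A then w x / sum w A else 0))"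
    using assms by (intro nn_integral_count_space') auto
  also have "\<dots> = (\<Sum>x\<in>A. ennreal (w x / sum w A))" by (intro sum.cong) auto
  also have "\<dots> = ennreal (\<Sum>x\<in>A. w x / sum w A)"
    using assms by (intro sum_ennreal) (simp add: less_imp_le)
  also have "\<dots> = 1" using assms by (simp add: sum_divide_distrib[symmetric])
  finally show "(\<integral>\<^sup>+ x. ennreal (if x \<in> A then w x / sum w A else 0) \<partial>count_space UNIV) = 1" .
qed

lemma pmf_bind_finite:
  assumes "finite A" "set_pmf p \<subseteq> A"
  shows "pmf (bind_pmf p f) y = (\<Sum>x\<in>A. pmf p x * pmf (f x) y)"
  unfolding pmf_bind using assms
  by (subst integral_measure_pmf_real[where A = A]) (auto simp: mult.commute)

lemma sum_atMost_Suc_split: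
  fixes f :: "nat \<Rightarrow> real"
  assumes "x \<le> m"
  shows "(\<Sum>i\<le>Suc m. f i) = (\<Sum>i\<le>x. f i) + (\<Sum>i\<in>{x..m}. f (Suc i))"
proof -
  have "{..Suc m} = {..x} \<union> {Suc x..Suc m}" using assms by auto
  hence "(\<Sum>i\<le>Suc m. f i) = (\<Sum>i\<le>x. f i) + (\<Sum>i\<in>{Suc x..Suc m}. f i)"
    by (simp add: sum.union_disjoint)
  also have "(\<Sum>i\<in>{Suc x..Suc m}. f i) = (\<Sum>i\<in>{x..m}. f (Suc i))"
    by (rule sum.shift_bounds_cl_Suc_ivl)
  finally show ?thesis .
qed

text \<open>
  From \<open>x\<close>, the amount \<open>flow x\<close> of the mass \<open>pmf p x\<close> has to move to \<open>x + 1\<close>, where \<open>flow x\<close> is the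
  excess of \<open>p\<close> over \<open>q\<close> on \<open>{..x}\<close>. It is nonnegative by the first pointwise bound. It is at most
  \<open>pmf p x\<close> by the second one, as seen by summing over the complementary tails.
\<close>

lemma rel_pmf_unit_step:
  fixes p q :: "nat pmf"
  assumes p: "set_pmf p \<subseteq> {..m}" and q: "set_pmf q \<subseteq> {..Suc m}"
    and stay: "\<And>x. x \<le> m \<Longrightarrow> pmf q x \<le> pmf p x"
    and jump: "\<And>x. x \<le> m \<Longrightarrow> pmf q (Suc x) \<le> pmf p x"
  shows "rel_pmf (\<lambda>x y. y = x \<or> y = Suc x) p q"
proof -
  define flow where "flow x = (\<Sum>i\<le>x. pmf p i - pmf q i)" for x
  have flow_nonneg: "flow x \<ge> 0" if "x \<le> m" for x
    unfolding flow_def using that by (intro sum_nonneg) (simp add: stay)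
  have flow_le: "flow x \<le> pmf p x" if x: "x \<le> m" for x
  proof -
    have "1 = (\<Sum>i\<le>Suc m. pmf q i)" using q by (subst sum_pmf_eq_1) auto
    also have "\<dots> = (\<Sum>i\<le>x. pmf q i) + (\<Sum>i\<in>{x..m}. pmf q (Suc i))"
      by (rule sum_atMost_Suc_split[OF x])
    also have "(\<Sum>i\<in>{x..m}. pmf q (Suc i)) \<le> (\<Sum>i\<in>{x..m}. pmf p i)"
      by (intro sum_mono jump) auto
    also have "(\<Sum>i\<in>{x..m}. pmf p i) = 1 - (\<Sum>i<x. pmf p i)"
    proof -
      have "{..m} = {..<x} \<union> {x..m}" using x by auto
      hence "(\<Sum>i\<le>m. pmf p i) = (\<Sum>i<x. pmf p i) + (\<Sum>i\<in>{x..m}. pmf p i)"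
        by (subst sum.union_disjoint[symmetric]) auto
      moreover have "(\<Sum>i\<le>m. pmf p i) = 1" using p by (subst sum_pmf_eq_1) auto
      ultimately show ?thesis by simp
    qed
    finally have "(\<Sum>i<x. pmf p i) \<le> (\<Sum>i\<le>x. pmf q i)" by simp
    moreover have "(\<Sum>i\<le>x. pmf p i) = (\<Sum>i<x. pmf p i) + pmf p x"
      by (simp add: lessThan_Suc_atMost[symmetric])
    ultimately show ?thesis unfolding flow_def sum_subtractf by simp
  qed
  define t where "t x = (if pmf p x = 0 then 0 else flow x / pmf p x)" for x
  have t: "0 \<le> t x" "t x \<le> 1" "pmf p x * t x = flow x" if "x \<le> m" for x
    using flow_nonneg[OF that] flow_le[OF that] pmf_nonneg[of p x]
    by (auto simp: t_def divide_simps)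
  define K where "K x = map_pmf (\<lambda>b. if b then Suc x else x) (bernoulli_pmf (t x))" for x
  have K: "pmf (K x) y = (if y = Suc x then t x else if y = x then 1 - t x else 0)" if "x \<le> m" for x y
  proof -
    have "pmf (K x) y = (\<Sum>b\<in>UNIV. pmf (bernoulli_pmf (t x)) b * indicator {y} (if b then Suc x else x))"
      unfolding K_def map_pmf_def pmf_bind
      by (subst integral_measure_pmf_real[where A = UNIV]) (auto simp: pmf_return indicator_def intro: sum.cong)
    thus ?thesis using t[OF that] by (auto simp: UNIV_bool indicator_def)
  qed
  have "bind_pmf p K = q"
  proof (rule pmf_eqI)
    fix y
    have "pmf (bind_pmf p K) y = (\<Sum>x\<le>m. pmf p x * pmf (K x) y)"
      using p by (intro pmf_bind_finite) auto
    also have "\<dots> = (\<Sum>x\<le>m. (if Suc x = y then flow x else 0) + (if x = y then pmf p x - flow x else 0))"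
      by (intro sum.cong) (auto simp: K t(3)[symmetric] right_diff_distrib)
    also have "\<dots> = (\<Sum>x\<le>m. if Suc x = y then flow x else 0) + (if y \<le> m then pmf p y - flow y else 0)"
      by (simp add: sum.distrib)
    also have "\<dots> = pmf q y"
    proof (cases y)
      case 0
      thus ?thesis by (simp add: flow_def)
    next
      case (Suc z)
      have out: "pmf p i = 0" if "i > m" for i using p that by (auto simp: set_pmf_eq)
      have "(\<Sum>x\<le>m. if Suc x = y then flow x else 0) = (if z \<le> m then flow z else 0)"
        using Suc by (simp add: sum.delta)
      moreover have "flow m = pmf q (Suc m)"
      proof -
        have "(\<Sum>i\<le>m. pmf p i) = 1" using p by (subst sum_pmf_eq_1) auto
        moreover have "(\<Sum>i\<le>Suc m. pmf q i) = 1" using q by (subst sum_pmf_eq_1) auto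
        ultimately show ?thesis by (simp add: flow_def sum_subtractf)
      qed
      moreover have "pmf q y = 0" if "y > Suc m" using q that by (auto simp: set_pmf_eq)
      moreover have "flow y = flow z + pmf p y - pmf q y" using Suc by (simp add: flow_def)
      ultimately show ?thesis using Suc by (cases "z < m"; cases "z = m") auto
    qed
    finally show "pmf (bind_pmf p K) y = pmf q y" .
  qed
  moreover have "rel_pmf (\<lambda>x y. y = x \<or> y = Suc x) (bind_pmf p return_pmf) (bind_pmf p K)"
    by (rule rel_pmf_bindI[where R = "(=)"])
       (auto simp: pmf.rel_eq rel_pmf_return_pmf1 K_def)
  ultimately show ?thesis by (simp add: bind_return_pmf')
qed

section \<open>Coupling conditioned forests\<close>

definition forest_law :: "nat pmf \<Rightarrow> nat \<Rightarrow> nat \<Rightarrow> forest pmf" where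
  "forest_law \<mu> s N = normalized_pmf {f. fsize f = N} (\<lambda>f. fweight \<mu> f s)"

lemma pmf_forest_law:
  "fmass \<mu> s N > 0 \<Longrightarrow>
     pmf (forest_law \<mu> s N) f = (if fsize f = N then fweight \<mu> f s / fmass \<mu> s N else 0)"
  unfolding forest_law_def fmass_def
  by (subst pmf_normalized) (auto simp: finite_fsize fweight_nonneg)

lemma forest_law_0: "pmf \<mu> s > 0 \<Longrightarrow> forest_law \<mu> s 0 = return_pmf Void"
proof (rule pmf_eqI)
  fix f assume "pmf \<mu> s > 0"
  thus "pmf (forest_law \<mu> s 0) f = pmf (return_pmf Void) f"
    by (cases f) (simp_all add: pmf_forest_law fmass_0)
qed

locale log_concave_offspring =
  fixes \<mu> :: "nat pmf" and d :: nat
  assumes mu0: "0 < pmf \<mu> 0" and mu0_less: "pmf \<mu> 0 < 1"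
    and d: "d \<ge> 1" and supp: "set_pmf \<mu> \<subseteq> {k. d dvd k}"
    and concave: "log_concave_seq (\<lambda>k. pmf \<mu> (k * d))"
begin

lemma fweight_dvd: "fweight \<mu> f s \<noteq> 0 \<Longrightarrow> d dvd s + fsize f"
proof (induction f arbitrary: s)
  case Void
  thus ?case using supp by (auto simp: set_pmf_eq)
next
  case (Branch f g)
  from Branch.prems have "fweight \<mu> f 0 \<noteq> 0" "fweight \<mu> g (Suc s) \<noteq> 0" by simp_all
  hence "d dvd (0 + fsize f) + (Suc s + fsize g)" by (intro dvd_add Branch.IH)
  thus ?case by (simp add: add_ac)
qed

text \<open>
  The numbers of children of the \<open>N\<close> vertices of the forest and of the vertex that carries it add up to
  \<open>s + N\<close>, and they are multiples of \<open>d\<close>.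
\<close>

lemma fmass_dvd: "fmass \<mu> s N \<noteq> 0 \<Longrightarrow> d dvd s + N"
  unfolding fmass_def using fweight_dvd[of _ s]
  by (elim sum.not_neutral_contains_not_neutral) blast

lemma fmass_Suc_multiples:
  "fmass \<mu> s (Suc N) = (\<Sum>x\<le>N div d. fmass \<mu> 0 (d * x) * fmass \<mu> (Suc s) (N - d * x))"
proof -
  have "fmass \<mu> s (Suc N) = (\<Sum>x\<in>(*) d ` {..N div d}. fmass \<mu> 0 x * fmass \<mu> (Suc s) (N - x))"
    unfolding fmass_Suc
  proof (rule sum.mono_neutral_right)
    show "(*) d ` {..N div d} \<subseteq> {..N}"
      using d by (auto simp: less_eq_div_iff_mult_less_eq mult.commute)
    show "\<forall>x\<in>{..N} - (*) d ` {..N div d}. fmass \<mu> 0 x * fmass \<mu> (Suc s) (N - x) = 0"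
    proof
      fix x assume x: "x \<in> {..N} - (*) d ` {..N div d}"
      have "\<not> d dvd x"
      proof
        assume "d dvd x"
        then obtain y where y: "x = d * y" by blast
        hence "y \<le> N div d" using x d by (simp add: less_eq_div_iff_mult_less_eq mult.commute)
        thus False using x y by blast
      qed
      thus "fmass \<mu> 0 x * fmass \<mu> (Suc s) (N - x) = 0"
        using fmass_dvd[of 0 x] by auto
    qed
  qed simp
  also have "\<dots> = (\<Sum>x\<le>N div d. fmass \<mu> 0 (d * x) * fmass \<mu> (Suc s) (N - d * x))"
    using d by (subst sum.reindex) (auto simp: inj_on_def)
  finally show ?thesis .
qed

text \<open>
  The law, in units of \<open>d\<close>, of the size of the forest above the first root, for a conditioned forest in
  state \<open>s\<close> with \<open>N + 1\<close> vertices.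
\<close>

definition split_law :: "nat \<Rightarrow> nat \<Rightarrow> nat pmf" where
  "split_law s N =
     normalized_pmf {..N div d} (\<lambda>x. fmass \<mu> 0 (d * x) * fmass \<mu> (Suc s) (N - d * x))"

lemma pmf_split_law:
  "fmass \<mu> s (Suc N) > 0 \<Longrightarrow> pmf (split_law s N) x =
     (if x \<le> N div d then fmass \<mu> 0 (d * x) * fmass \<mu> (Suc s) (N - d * x) / fmass \<mu> s (Suc N) else 0)"
proof -
  assume "fmass \<mu> s (Suc N) > 0"
  hence "(\<Sum>x\<le>N div d. fmass \<mu> 0 (d * x) * fmass \<mu> (Suc s) (N - d * x)) > 0"
    by (simp only: fmass_Suc_multiples)
  thus ?thesis
    unfolding split_law_def fmass_Suc_multiples[of s N]
    by (subst pmf_normalized) (simp_all add: fmass_nonneg)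
qed

lemma set_split_law:
  assumes "fmass \<mu> s (Suc N) > 0" "x \<in> set_pmf (split_law s N)"
  shows "d * x \<le> N" "fmass \<mu> 0 (d * x) > 0" "fmass \<mu> (Suc s) (N - d * x) > 0"
proof -
  have "pmf (split_law s N) x \<noteq> 0" using assms(2) by (simp add: set_pmf_iff)
  hence "x \<le> N div d" and nz: "fmass \<mu> 0 (d * x) \<noteq> 0" "fmass \<mu> (Suc s) (N - d * x) \<noteq> 0"
    unfolding pmf_split_law[OF assms(1)] by (simp_all split: if_splits)
  from mult_le_mono2[OF this(1), of d] show "d * x \<le> N"
    using times_div_less_eq_dividend[of d N] by (rule order_trans)
  show "fmass \<mu> 0 (d * x) > 0" "fmass \<mu> (Suc s) (N - d * x) > 0"
    using nz fmass_nonneg[of \<mu>] by (simp_all add: less_le)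
qed

text \<open>
  The weight of \<open>Branch f g\<close> is a product, so \<open>f\<close> and \<open>g\<close> are independent conditioned forests given their
  sizes.
\<close>

lemma forest_law_Suc:
  assumes pos: "fmass \<mu> s (Suc N) > 0"
  shows "forest_law \<mu> s (Suc N) =
    bind_pmf (split_law s N) (\<lambda>x. map_pmf (case_prod Branch)
      (pair_pmf (forest_law \<mu> 0 (d * x)) (forest_law \<mu> (Suc s) (N - d * x))))"
    (is "_ = bind_pmf _ ?K")
proof (rule pmf_eqI)
  fix h
  have sub: "set_pmf (split_law s N) \<subseteq> {..N div d}"
    using pos by (auto simp: set_pmf_eq pmf_split_law split: if_splits)
  have "pmf (bind_pmf (split_law s N) ?K) h = (\<Sum>x\<le>N div d. pmf (split_law s N) x * pmf (?K x) h)"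
    by (rule pmf_bind_finite[OF _ sub]) simp
  also have "\<dots> = pmf (forest_law \<mu> s (Suc N)) h"
  proof (cases h)
    case Void
    have "pmf (?K x) Void = 0" for x by (auto simp: pmf_eq_0_set_pmf)
    thus ?thesis using pos by (simp add: Void pmf_forest_law)
  next
    case (Branch f g)
    have inj: "inj (case_prod Branch)" by (auto simp: inj_on_def)
    have K: "pmf (?K x) h = pmf (forest_law \<mu> 0 (d * x)) f * pmf (forest_law \<mu> (Suc s) (N - d * x)) g" for x
      using pmf_map_inj'[OF inj, of _ "(f, g)"] by (simp add: Branch pmf_pair)
    have summand: "pmf (split_law s N) x * pmf (?K x) h =
        (if fsize f = d * x \<and> fsize f + fsize g = N then fweight \<mu> h s / fmass \<mu> s (Suc N) else 0)"
      if x: "x \<le> N div d" for x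
    proof (cases "fmass \<mu> 0 (d * x) > 0 \<and> fmass \<mu> (Suc s) (N - d * x) > 0")
      case True
      have "d * x \<le> N" using x d by (simp add: less_eq_div_iff_mult_less_eq mult.commute)
      thus ?thesis
        unfolding K using True x pos by (auto simp: pmf_split_law pmf_forest_law Branch)
    next
      case False
      hence zero: "fmass \<mu> 0 (d * x) = 0 \<or> fmass \<mu> (Suc s) (N - d * x) = 0"
        using fmass_nonneg[of \<mu> 0 "d * x"] fmass_nonneg[of \<mu> "Suc s" "N - d * x"] by linarith
      hence "pmf (split_law s N) x = 0" using pos by (auto simp: pmf_split_law)
      moreover have "fweight \<mu> h s = 0" if "fsize f = d * x" "fsize f + fsize g = N"
      proof -
        have "fweight \<mu> f 0 \<le> fmass \<mu> 0 (fsize f)" "fweight \<mu> g (Suc s) \<le> fmass \<mu> (Suc s) (fsize g)"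
          unfolding fmass_def by (auto intro!: member_le_sum simp: finite_fsize fweight_nonneg)
        thus ?thesis
          using zero that fweight_nonneg[of \<mu> f 0] fweight_nonneg[of \<mu> g "Suc s"]
          by (auto simp: Branch)
      qed
      ultimately show ?thesis by auto
    qed
    have "(\<Sum>x\<le>N div d. pmf (split_law s N) x * pmf (?K x) h) = (\<Sum>x\<le>N div d.
        if fsize f = d * x \<and> fsize f + fsize g = N then fweight \<mu> h s / fmass \<mu> s (Suc N) else 0)"
      by (intro sum.cong refl summand) simp
    also have "\<dots> = pmf (forest_law \<mu> s (Suc N)) h"
    proof (cases "fsize f + fsize g = N \<and> fweight \<mu> h s \<noteq> 0")
      case True
      have "d dvd fsize f" using fweight_dvd[of f 0] True by (auto simp: Branch)
      then obtain y where y: "fsize f = d * y" by blast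
      hence "d * y \<le> N" using True by simp
      hence "y \<le> N div d" using d by (simp add: less_eq_div_iff_mult_less_eq mult.commute)
      moreover have "fsize f = d * x \<longleftrightarrow> x = y" for x using y d by auto
      ultimately show ?thesis
        using True by (simp add: pmf_forest_law[OF pos] Branch)
    next
      case False
      have "(\<Sum>x\<le>N div d. if fsize f = d * x \<and> fsize f + fsize g = N
          then fweight \<mu> h s / fmass \<mu> s (Suc N) else 0) = 0"
        by (rule sum.neutral) (use False in auto)
      moreover have "pmf (forest_law \<mu> s (Suc N)) h = 0"
        unfolding pmf_forest_law[OF pos] using False by (auto simp: Branch)
      ultimately show ?thesis by simp
    qed
    finally show ?thesis .
  qed
  finally show "pmf (forest_law \<mu> s (Suc N)) h = pmf (bind_pmf (split_law s N) ?K) h" by simp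
qed

definition degree_weight :: "nat \<Rightarrow> real" where
  "degree_weight k = pmf \<mu> (k * d)"

definition G :: "nat \<Rightarrow> nat \<Rightarrow> real" where
  "G j m = fmass \<mu> (d * j) (d * m)"

text \<open>
  Starting from state \<open>jd - i\<close>, the next \<open>i\<close> trees contribute a factor \<open>A\<close> each, since no vertex can stop
  having children before its number of children is a multiple of \<open>d\<close>; then state \<open>jd\<close> is reached. Each
  of these trees has one root besides its multiple of \<open>d\<close> vertices, which is the summand \<open>i\<close> in the size.
\<close>

lemma conv_power_G:
  "i \<le> d \<Longrightarrow> s + i = d * j \<Longrightarrow> (conv (G 0) ^^ i) (G j) m = fmass \<mu> s (i + d * m)"
proof (induction i arbitrary: s m)
  case (Suc i)
  have "(i + d * m) div d = m" using Suc.prems by simp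
  moreover have "i + d * m - d * x = i + d * (m - x)" if "x \<le> m" for x
    using that by (simp add: diff_mult_distrib2)
  ultimately have "fmass \<mu> s (Suc (i + d * m)) = (\<Sum>x\<le>m. G 0 x * fmass \<mu> (Suc s) (i + d * (m - x)))"
    unfolding fmass_Suc_multiples by (simp add: G_def)
  also have "\<dots> = (\<Sum>x\<le>m. G 0 x * (conv (G 0) ^^ i) (G j) (m - x))"
    using Suc.prems by (intro sum.cong refl) (subst Suc.IH[of "Suc s"], auto)
  finally show ?case by (simp add: conv_def[of _ "(conv (G 0) ^^ i) (G j)"])
qed (simp add: G_def)

lemma degree_weight_0_pos: "degree_weight 0 > 0"
  and degree_weight_1_pos: "degree_weight (Suc 0) > 0"
  and degree_weight_down: "degree_weight (Suc j) > 0 \<Longrightarrow> degree_weight j > 0"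
  and degree_weight_concave: "degree_weight j * degree_weight (Suc (Suc j)) \<le> degree_weight (Suc j) * degree_weight (Suc j)"
proof -
  have conc: "pmf \<mu> ((i - 1) * d) * pmf \<mu> ((i + 1) * d) \<le> (pmf \<mu> (i * d))\<^sup>2" if "i \<ge> 1" for i
    using concave that unfolding log_concave_seq_def by blast
  have zeros: "(\<Prod>k\<in>{i..j}. pmf \<mu> (k * d)) \<noteq> 0"
    if "i < j" "pmf \<mu> (i * d) * pmf \<mu> (j * d) \<noteq> 0" for i j
    using concave that unfolding log_concave_seq_def by blast
  have interval: "degree_weight i > 0" if "degree_weight j > 0" "i \<le> j" for i j
  proof (cases "j = 0")
    case False
    have "(\<Prod>k\<in>{0..j}. pmf \<mu> (k * d)) \<noteq> 0"
      using zeros[of 0 j] False that mu0 by (simp add: degree_weight_def)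
    hence "pmf \<mu> (i * d) \<noteq> 0" using that by auto
    thus ?thesis by (simp add: degree_weight_def pmf_positive_iff set_pmf_eq)
  qed (use that in simp)
  show "degree_weight 0 > 0" using mu0 by (simp add: degree_weight_def)
  show "degree_weight j > 0" if "degree_weight (Suc j) > 0" using interval[OF that] by simp
  show "degree_weight j * degree_weight (Suc (Suc j)) \<le> degree_weight (Suc j) * degree_weight (Suc j)"
    using conc[of "Suc j"] by (simp add: degree_weight_def power2_eq_square)
  have "\<not> set_pmf \<mu> \<subseteq> {0}"
    using mu0_less by (auto simp: set_pmf_subset_singleton)
  then obtain k where k: "k \<in> set_pmf \<mu>" "k \<noteq> 0" by blast
  then obtain l where l: "k = d * l" using supp by auto
  have "degree_weight l > 0"
    using k l by (simp add: degree_weight_def mult.commute pmf_positive_iff)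
  thus "degree_weight (Suc 0) > 0"
    using interval[of l "Suc 0"] k l by (cases l) auto
qed

lemma G_zero_level: "degree_weight j = 0 \<Longrightarrow> G j m = 0"
proof -
  assume j: "degree_weight j = 0"
  have zero: "degree_weight i = 0" if "i \<ge> j" for i
    using that
  proof (induction i rule: dec_induct)
    case (step i)
    thus ?case using degree_weight_down[of i] pmf_nonneg[of \<mu> "Suc i * d"]
      by (fastforce simp: degree_weight_def less_le)
  qed (rule j)
  have "pmf \<mu> t = 0" if "t \<ge> d * j" for t
  proof (cases "d dvd t")
    case True
    then obtain i where "t = d * i" by blast
    thus ?thesis using zero[of i] that d by (simp add: degree_weight_def mult.commute)
  qed (use supp in \<open>auto simp: set_pmf_eq\<close>)
  hence "fweight \<mu> f s = 0" if "s \<ge> d * j" for f s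
    using that by (induction f arbitrary: s) auto
  thus ?thesis by (simp add: G_def fmass_def)
qed

sublocale series_recursion degree_weight G d
proof
  show "G j (Suc m) = (conv (G 0) ^^ d) (G (Suc j)) m" for j m
    by (subst conv_power_G[of d "d * j"]) (simp_all add: G_def)
qed (use d degree_weight_0_pos degree_weight_1_pos degree_weight_down degree_weight_concave
       G_zero_level fmass_nonneg in
     \<open>auto simp: G_def fmass_0 degree_weight_def mult.commute\<close>)

text \<open>
  The size of the forest above the first root stays the same or grows by \<open>d\<close> when the whole forest
  grows by \<open>d\<close>.
\<close>

lemma split_law_step:
  assumes pos: "fmass \<mu> s (Suc N) > 0" and pos': "fmass \<mu> s (Suc (N + d)) > 0"
  shows "rel_pmf (\<lambda>x y. y = x \<or> y = Suc x) (split_law s N) (split_law s (N + d))"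
proof -
  define m where "m = N div d"
  \<comment> \<open>\<open>s + i\<close> is the first multiple of \<open>d\<close> above \<open>s\<close>. If \<open>s\<close> is a multiple of \<open>d\<close> then \<open>i = d\<close>, not 0: the forest
    is nonempty, so the vertex that carries it gets \<open>d\<close> more children at least.\<close>
  define i where "i = Suc (N mod d)"
  have N: "N = (i - 1) + d * m" by (simp add: m_def i_def)
  have i: "1 \<le> i" "i \<le> d" using d by (auto simp: i_def Suc_le_eq)
  have m': "(N + d) div d = Suc m" using d by (simp add: m_def)
  have "d dvd s + Suc N" using fmass_dvd[of s "Suc N"] pos by auto
  moreover have "s + Suc N = (s + i) + d * m" using N i by simp
  ultimately have "d dvd s + i" by (metis dvd_add_left_iff dvd_triv_left)
  then obtain j where j: "s + i = d * Suc j"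
    using i by (metis One_nat_def add_is_0 dvdE mult_is_0 not0_implies_Suc not_one_le_zero)
  have W: "C i (Suc j) n = fmass \<mu> s (i + d * n)" for n
    by (rule conv_power_G[OF i(2) j])
  have V: "C (i - 1) (Suc j) n = fmass \<mu> (Suc s) ((i - 1) + d * n)" for n
    using i j by (intro conv_power_G) auto
  have Wm: "fmass \<mu> s (Suc N) = C i (Suc j) m"
    unfolding W using N i by simp
  have Wm': "fmass \<mu> s (Suc (N + d)) = C i (Suc j) (Suc m)"
    unfolding W using N i by (simp add: algebra_simps)
  have "degree_weight (Suc j) \<noteq> 0"
  proof
    assume "degree_weight (Suc j) = 0"
    hence "G (Suc j) = (\<lambda>_. 0)" using G_zero_level by auto
    moreover have "(conv a ^^ n) (\<lambda>_. 0) = (\<lambda>_. 0)" for n by (induction n) (auto simp: conv_def)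
    ultimately show False using pos Wm by simp
  qed
  hence pj: "degree_weight (Suc j) > 0" by (simp add: p_pos_iff)
  have rest: "fmass \<mu> (Suc s) (N - d * x) = C (i - 1) (Suc j) (m - x)" if "x \<le> m" for x
    unfolding V using N that by (simp add: diff_mult_distrib2)
  have rest': "fmass \<mu> (Suc s) (N + d - d * x) = C (i - 1) (Suc j) (Suc m - x)" if "x \<le> Suc m" for x
  proof -
    have "N + d = (i - 1) + d * Suc m" using N by simp
    moreover have "d * x \<le> d * Suc m" using that by (rule mult_le_mono2)
    ultimately have "N + d - d * x = (i - 1) + d * (Suc m - x)"
      unfolding diff_mult_distrib2 by simp
    thus ?thesis by (simp only: V)
  qed
  have A: "fmass \<mu> 0 (d * x) = a x" for x by (simp add: G_def)
  have ratio_a: "a (Suc y) * C i (Suc j) m \<le> a y * C i (Suc j) (Suc m)" if "y \<le> m" for y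
    by (rule step_ratio[OF pj i ratio_a_le_C[OF pj i(1)] G_nonneg that])
  have ratio_V: "C (i - 1) (Suc j) (Suc y) * C i (Suc j) m \<le> C (i - 1) (Suc j) y * C i (Suc j) (Suc m)"
    if "y \<le> m" for y
    by (rule step_ratio[OF pj i ratio_C_mono[OF pj] C_nonneg that]) simp
  have W_pos: "C i (Suc j) m > 0" "C i (Suc j) (Suc m) > 0" using pos pos' Wm Wm' by simp_all
  note pmfs = pmf_split_law[OF pos] pmf_split_law[OF pos'] Wm Wm' A m' m_def[symmetric]
  show ?thesis
  proof (rule rel_pmf_unit_step[where m = m])
    show "set_pmf (split_law s N) \<subseteq> {..m}" "set_pmf (split_law s (N + d)) \<subseteq> {..Suc m}"
      by (auto simp: set_pmf_eq pmfs split: if_splits)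
    fix x assume x: "x \<le> m"
    show "pmf (split_law s (N + d)) x \<le> pmf (split_law s N) x"
      using mult_left_mono[OF ratio_V[of "m - x"] G_nonneg[of 0 x]] W_pos x
      by (simp add: pmfs rest rest' Suc_diff_le divide_simps mult_ac)
    show "pmf (split_law s (N + d)) (Suc x) \<le> pmf (split_law s N) x"
      using mult_right_mono[OF ratio_a[OF x] C_nonneg[of "i - 1" "Suc j" "m - x"]] W_pos x
      by (simp add: pmfs A[of "Suc x", simplified] rest divide_simps mult_ac)
  qed
qed

text \<open>
  The coupling of sizes tells which of the two parts of the forest grows. This part is grown by the
  coupling obtained by induction, while the other part is kept. The part that grows is smaller than the
  whole forest, by at least the first root.
\<close>

lemma forest_law_step:
  assumes "fmass \<mu> s N > 0" "fmass \<mu> s (N + d) > 0"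
  shows "rel_pmf (\<lambda>f g. vertices f \<subseteq> vertices g) (forest_law \<mu> s N) (forest_law \<mu> s (N + d))"
  using assms
proof (induction N arbitrary: s rule: less_induct)
  case (less N)
  show ?case
  proof (cases N)
    case 0
    thus ?thesis using less.prems by (simp add: forest_law_0 fmass_0 rel_pmf_return_pmf1)
  next
    case (Suc M)
    have pos: "fmass \<mu> s (Suc M) > 0" "fmass \<mu> s (Suc (M + d)) > 0"
      using less.prems Suc by simp_all
    define S where "S x y \<longleftrightarrow> (y = x \<or> y = Suc x) \<and> x \<in> set_pmf (split_law s M) \<and>
      y \<in> set_pmf (split_law s (M + d))" for x y
    have split: "rel_pmf S (split_law s M) (split_law s (M + d))"
      by (rule pmf.rel_mono_strong[OF split_law_step[OF pos]]) (simp add: S_def)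
    have glue: "rel_pmf (\<lambda>f g. vertices f \<subseteq> vertices g)
        (map_pmf (case_prod Branch) (pair_pmf p q)) (map_pmf (case_prod Branch) (pair_pmf p' q'))"
      if "rel_pmf (\<lambda>f g. vertices f \<subseteq> vertices g) p p'"
        "rel_pmf (\<lambda>f g. vertices f \<subseteq> vertices g) q q'" for p p' q q'
    proof -
      have "rel_pmf (rel_prod (\<lambda>f g. vertices f \<subseteq> vertices g) (\<lambda>f g. vertices f \<subseteq> vertices g))
          (pair_pmf p q) (pair_pmf p' q')"
        using that by (simp add: rel_pmf_rel_prod)
      thus ?thesis
        unfolding pmf.rel_map
        by (rule pmf.rel_mono_strong) (auto intro!: vertices_Branch_mono simp del: vertices.simps del: subsetI)
    qed
    have "rel_pmf (\<lambda>f g. vertices f \<subseteq> vertices g)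
      (map_pmf (case_prod Branch) (pair_pmf (forest_law \<mu> 0 (d * x)) (forest_law \<mu> (Suc s) (M - d * x))))
      (map_pmf (case_prod Branch) (pair_pmf (forest_law \<mu> 0 (d * y)) (forest_law \<mu> (Suc s) (M + d - d * y))))"
      if xy: "S x y" for x y
    proof (rule glue)
      have "x \<in> set_pmf (split_law s M)" "y \<in> set_pmf (split_law s (M + d))"
        using xy by (simp_all add: S_def)
      note x = set_split_law[OF pos(1) this(1)] and y = set_split_law[OF pos(2) this(2)]
      consider "y = x" | "y = Suc x" using xy by (auto simp: S_def)
      hence "rel_pmf (\<lambda>f g. vertices f \<subseteq> vertices g) (forest_law \<mu> 0 (d * x)) (forest_law \<mu> 0 (d * y)) \<and>
        rel_pmf (\<lambda>f g. vertices f \<subseteq> vertices g)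
          (forest_law \<mu> (Suc s) (M - d * x)) (forest_law \<mu> (Suc s) (M + d - d * y))"
      proof cases
        case 1
        have "M + d - d * y = M - d * x + d" using x 1 by simp
        thus ?thesis
          using less.IH[of "M - d * x" "Suc s"] x y 1 Suc by (auto intro: rel_pmf_reflI)
      next
        case 2
        have "M + d - d * y = M - d * x" "d * y = d * x + d" using x 2 by simp_all
        thus ?thesis
          using less.IH[of "d * x" 0] x y Suc by (auto intro: rel_pmf_reflI)
      qed
      thus "rel_pmf (\<lambda>f g. vertices f \<subseteq> vertices g) (forest_law \<mu> 0 (d * x)) (forest_law \<mu> 0 (d * y))"
        "rel_pmf (\<lambda>f g. vertices f \<subseteq> vertices g)
          (forest_law \<mu> (Suc s) (M - d * x)) (forest_law \<mu> (Suc s) (M + d - d * y))"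
        by blast+
    qed
    thus ?thesis
      unfolding Suc add_Suc forest_law_Suc[OF pos(1)] forest_law_Suc[OF pos(2)]
      by (rule rel_pmf_bindI[OF split])
  qed
qed

end

section \<open>Markov chains from couplings\<close>

text \<open>
  The kernel is the conditional law of the second coordinate of a coupling given the first one.
\<close>

lemma rel_pmf_kernel:
  assumes "rel_pmf R p q"
  obtains K where "bind_pmf p K = q" "\<And>x y. x \<in> set_pmf p \<Longrightarrow> y \<in> set_pmf (K x) \<Longrightarrow> R x y"
proof -
  obtain pq where pq: "\<And>x y. (x, y) \<in> set_pmf pq \<Longrightarrow> R x y" "map_pmf fst pq = p" "map_pmf snd pq = q"
    using assms by (auto elim: rel_pmf.cases)
  have nonempty: "set_pmf pq \<inter> {z. fst z = x} \<noteq> {}" if "x \<in> set_pmf p" for x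
    using that pq(2) by auto
  have "bind_pmf p (\<lambda>x. cond_pmf pq {z. fst z = x}) = pq"
  proof (rule bind_cond_pmf_cancel[where R = "\<lambda>x z. fst z = x"])
    fix z assume "z \<in> set_pmf pq"
    thus "set_pmf p \<inter> {x. fst z = x} \<noteq> {}" using pq(2) by auto
  next
    fix x z assume "x \<in> set_pmf p" "z \<in> set_pmf pq" "fst z = x"
    have "measure (measure_pmf p) {x'. fst z = x'} = measure (measure_pmf pq) (fst -` {x'. fst z = x'})"
      unfolding pq(2)[symmetric] by (rule measure_map_pmf)
    also have "fst -` {x'. fst z = x'} = {z. fst z = x}" using \<open>fst z = x\<close> by auto
    finally show "measure (measure_pmf pq) {z. fst z = x} = measure (measure_pmf p) {x. fst z = x}" ..
  qed (rule nonempty)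
  hence "bind_pmf p (\<lambda>x. map_pmf snd (cond_pmf pq {z. fst z = x})) = q"
    unfolding map_bind_pmf[symmetric] by (simp add: pq(3))
  moreover have "R x y" if "x \<in> set_pmf p" "y \<in> set_pmf (map_pmf snd (cond_pmf pq {z. fst z = x}))" for x y
    using that pq(1) by (auto simp: set_cond_pmf[OF nonempty])
  ultimately show thesis by (rule that)
qed

lemma measurable_count_space_subset:
  assumes "f \<in> measurable M (count_space UNIV)" "\<And>x. x \<in> space M \<Longrightarrow> f x \<in> A"
  shows "f \<in> measurable M (count_space A)"
proof (rule measurableI)
  fix B assume "B \<in> sets (count_space A)"
  thus "f -` B \<inter> space M \<in> sets M" by (intro measurable_sets[OF assms(1)]) simp
qed (use assms(2) in simp)

text \<open>
  The Markov chain with kernels \<open>K (n + 1)\<close> is realised by independent innovations: for every time \<open>n\<close>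
  and every state \<open>x\<close> there is a variable with law \<open>K n x\<close>, and a chain in state \<open>x\<close> at time \<open>n - 1\<close> moves to
  its value. Thus the chain up to time \<open>n\<close> depends only on the innovations of times up to \<open>n\<close>. The initial
  law is included as a kernel at time 0 that does not depend on the state.
\<close>

locale kernel_chain =
  fixes P :: "nat \<Rightarrow> 's pmf" and K :: "nat \<Rightarrow> 's \<Rightarrow> 's pmf"
  assumes K_0: "K 0 x = P 0" and K_Suc: "bind_pmf (P n) (K (Suc n)) = P (Suc n)"
    and fin: "finite (set_pmf (P n))"
begin

text \<open>
  The sample space is cut down to the support, so that a relation that holds for all possible
  transitions holds for every outcome, not just almost surely.
\<close>

definition innovation :: "nat \<times> 's \<Rightarrow> 's measure" where
  "innovation k = restrict_space (measure_pmf (case_prod K k)) (set_pmf (case_prod K k))"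

abbreviation \<Omega> :: "(nat \<times> 's \<Rightarrow> 's) measure" where
  "\<Omega> \<equiv> PiM UNIV innovation"

primrec X :: "nat \<Rightarrow> (nat \<times> 's \<Rightarrow> 's) \<Rightarrow> 's" where
  "X 0 \<omega> = \<omega> (0, undefined)"
| "X (Suc n) \<omega> = \<omega> (Suc n, X n \<omega>)"

abbreviation past :: "nat \<Rightarrow> (nat \<times> 's) set" where "past n \<equiv> {..n} \<times> UNIV"

lemma prob_space_innovation: "prob_space (innovation k)"
  unfolding innovation_def
  by (rule prob_space_restrict_space) (simp_all add: measure_pmf.emeasure_eq_1_AE AE_measure_pmf)

sublocale Omega: prob_space \<Omega>
  by (rule prob_space_PiM) (rule prob_space_innovation)

lemma space_innovation: "space (innovation (n, x)) = set_pmf (K n x)"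
  by (simp add: innovation_def space_restrict_space)

lemma measurable_coordinate:
  "k \<in> I \<Longrightarrow> (\<lambda>\<omega>. \<omega> k) \<in> measurable (PiM I innovation) (count_space UNIV)"
proof -
  assume "k \<in> I"
  hence "(\<lambda>\<omega>. \<omega> k) \<in> measurable (PiM I innovation) (innovation k)"
    by (rule measurable_component_singleton)
  moreover have "(\<lambda>x. x) \<in> measurable (innovation k) (count_space UNIV)"
    unfolding innovation_def by (intro measurable_restrict_space1) simp
  ultimately show ?thesis by (rule measurable_compose)
qed

lemma X_in_support:
  "past n \<subseteq> I \<Longrightarrow> \<omega> \<in> space (PiM I innovation) \<Longrightarrow> X n \<omega> \<in> set_pmf (P n)"
proof (induction n)
  case 0
  hence "\<omega> (0, undefined) \<in> space (innovation (0, undefined))"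
    by (auto simp: space_PiM PiE_def)
  thus ?case by (simp add: space_innovation K_0)
next
  case (Suc n)
  have "past n \<subseteq> I" using Suc.prems(1) by auto
  hence "X n \<omega> \<in> set_pmf (P n)" using Suc by blast
  moreover have "(Suc n, X n \<omega>) \<in> I" using Suc.prems(1) by auto
  hence "\<omega> (Suc n, X n \<omega>) \<in> space (innovation (Suc n, X n \<omega>))"
    using Suc.prems(2) by (auto simp: space_PiM PiE_def)
  ultimately show ?case
    by (auto simp: space_innovation simp flip: K_Suc)
qed

lemma measurable_X:
  "past n \<subseteq> I \<Longrightarrow> X n \<in> measurable (PiM I innovation) (count_space (set_pmf (P n)))"
proof (induction n)
  case 0
  have "X 0 = (\<lambda>\<omega>. \<omega> (0, undefined))" by (rule ext) simp
  hence "X 0 \<in> measurable (PiM I innovation) (count_space UNIV)"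
    using 0 by (simp add: measurable_coordinate subset_iff)
  thus ?case by (rule measurable_count_space_subset) (rule X_in_support[OF 0])
next
  case (Suc n)
  have "past n \<subseteq> I" using Suc.prems by auto
  hence IH: "X n \<in> measurable (PiM I innovation) (count_space (set_pmf (P n)))"
    by (rule Suc.IH)
  have "(\<lambda>\<omega>. \<omega> (Suc n, X n \<omega>)) \<in> measurable (PiM I innovation) (count_space UNIV)"
    by (rule measurable_compose_countable'[OF _ IH])
       (use Suc.prems in \<open>auto intro: measurable_coordinate\<close>)
  hence "X (Suc n) \<in> measurable (PiM I innovation) (count_space UNIV)"
    by (simp cong: measurable_cong)
  thus ?case by (rule measurable_count_space_subset) (rule X_in_support[OF Suc.prems])
qed

lemma X_restrict: "m \<le> n \<Longrightarrow> X m (restrict \<omega> (past n)) = X m \<omega>"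
  by (induction m) auto

lemma prob_coordinate: "measure \<Omega> {\<omega> \<in> space \<Omega>. \<omega> (n, x) = y} = pmf (K n x) y"
proof -
  let ?A = "{y} \<inter> set_pmf (K n x)"
  have A: "?A \<in> sets (innovation (n, x))"
    by (auto simp: innovation_def sets_restrict_space)
  have "{\<omega> \<in> space \<Omega>. \<omega> (n, x) = y} = (\<lambda>\<omega>. \<omega> (n, x)) -` ?A \<inter> space \<Omega>"
    by (auto simp: space_PiM PiE_def space_innovation[symmetric])
  hence "measure \<Omega> {\<omega> \<in> space \<Omega>. \<omega> (n, x) = y}
      = measure (distr \<Omega> (innovation (n, x)) (\<lambda>\<omega>. \<omega> (n, x))) ?A"
    using A by (simp add: measure_distr)
  also have "distr \<Omega> (innovation (n, x)) (\<lambda>\<omega>. \<omega> (n, x)) = innovation (n, x)"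
    by (rule distr_PiM_component) (auto intro: prob_space_innovation)
  also have "measure (innovation (n, x)) ?A = measure (measure_pmf (K n x)) ?A"
    unfolding innovation_def by (subst measure_restrict_space) auto
  also have "\<dots> = pmf (K n x) y"
    by (simp add: measure_Int_set_pmf pmf.rep_eq)
  finally show ?thesis .
qed

lemma indep_coordinates: "Omega.indep_vars innovation (\<lambda>k \<omega>. \<omega> k) UNIV"
proof (subst Omega.indep_vars_iff_distr_eq_PiM')
  have "distr \<Omega> \<Omega> (\<lambda>\<omega>. \<lambda>k\<in>UNIV. \<omega> k) = \<Omega>"
    by (simp add: restrict_UNIV)
  also have "\<dots> = PiM UNIV (\<lambda>k. distr \<Omega> (innovation k) (\<lambda>\<omega>. \<omega> k))"
    by (intro PiM_cong refl) (simp add: distr_PiM_component prob_space_innovation)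
  finally show "distr \<Omega> \<Omega> (\<lambda>\<omega>. \<lambda>k\<in>UNIV. \<omega> k) =
      PiM UNIV (\<lambda>k. distr \<Omega> (innovation k) (\<lambda>\<omega>. \<omega> k))" .
qed auto

text \<open>
  The innovations of time \<open>n + 1\<close> are independent of those up to time \<open>n\<close>.
\<close>

lemma prob_past_and_next:
  assumes A: "A \<in> sets (PiM (past n) innovation)"
  shows "measure \<Omega> {\<omega> \<in> space \<Omega>. restrict \<omega> (past n) \<in> A \<and> \<omega> (Suc n, x) = y}
       = measure \<Omega> {\<omega> \<in> space \<Omega>. restrict \<omega> (past n) \<in> A} * pmf (K (Suc n) x) y"
proof -
  let ?k = "(Suc n, x)"
  let ?B = "{h \<in> space (PiM {?k} innovation). h ?k = y}"
  have B: "?B \<in> sets (PiM {?k} innovation)"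
  proof -
    have "?B = (\<lambda>h. h ?k) -` {y} \<inter> space (PiM {?k} innovation)" by auto
    thus ?thesis using measurable_sets[OF measurable_coordinate[of ?k "{?k}"], of "{y}"] by simp
  qed
  have "Omega.indep_var (PiM (past n) innovation) (\<lambda>\<omega>. restrict \<omega> (past n))
      (PiM {?k} innovation) (\<lambda>\<omega>. restrict \<omega> {?k})"
    using Omega.indep_var_restrict[OF indep_coordinates, of "past n" "{?k}"] by auto
  from Omega.indep_varD[OF this A B]
  have "measure \<Omega> ((\<lambda>\<omega>. (restrict \<omega> (past n), restrict \<omega> {?k})) -` (A \<times> ?B) \<inter> space \<Omega>) =
    measure \<Omega> ((\<lambda>\<omega>. restrict \<omega> (past n)) -` A \<inter> space \<Omega>) *
    measure \<Omega> ((\<lambda>\<omega>. restrict \<omega> {?k}) -` ?B \<inter> space \<Omega>)" .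
  also have "(\<lambda>\<omega>. restrict \<omega> {?k}) -` ?B \<inter> space \<Omega> = {\<omega> \<in> space \<Omega>. \<omega> ?k = y}"
    by (auto simp: space_PiM)
  also have "(\<lambda>\<omega>. (restrict \<omega> (past n), restrict \<omega> {?k})) -` (A \<times> ?B) \<inter> space \<Omega> =
      {\<omega> \<in> space \<Omega>. restrict \<omega> (past n) \<in> A \<and> \<omega> ?k = y}"
    by (auto simp: space_PiM)
  also have "(\<lambda>\<omega>. restrict \<omega> (past n)) -` A \<inter> space \<Omega> = {\<omega> \<in> space \<Omega>. restrict \<omega> (past n) \<in> A}"
    by auto
  finally show ?thesis unfolding prob_coordinate .
qed

text \<open>
  The events considered are those given by the values of the chain at some times up to \<open>n\<close>, including
  \<open>n\<close> itself. Taking all times gives the conditional law given the whole past, taking only time \<open>n\<close> the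
  conditional law given the present; the two agree, which is the Markov property.
\<close>

lemma prob_step:
  assumes Q: "\<And>\<omega>. \<omega> \<in> space \<Omega> \<Longrightarrow> Q \<omega> \<longleftrightarrow> (\<forall>i\<in>J. X i \<omega> = h i)" and J: "J \<subseteq> {..n}" "n \<in> J"
  shows "measure \<Omega> {\<omega> \<in> space \<Omega>. X (Suc n) \<omega> = y \<and> Q \<omega>}
       = measure \<Omega> {\<omega> \<in> space \<Omega>. Q \<omega>} * pmf (K (Suc n) (h n)) y"
proof -
  define A where "A = {\<omega> \<in> space (PiM (past n) innovation). \<forall>i\<in>J. X i \<omega> = h i}"
  have "finite J" using J(1) by (rule finite_subset) simp
  have A: "A \<in> sets (PiM (past n) innovation)"
    unfolding A_def
  proof (rule sets.sets_Collect_finite_All'[OF _ \<open>finite J\<close>])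
    fix i assume "i \<in> J"
    hence "past i \<subseteq> past n" using J by auto
    from measurable_sets[OF measurable_X[OF this], of "{h i} \<inter> set_pmf (P i)"]
    have "X i -` ({h i} \<inter> set_pmf (P i)) \<inter> space (PiM (past n) innovation)
        \<in> sets (PiM (past n) innovation)" by simp
    also have "X i -` ({h i} \<inter> set_pmf (P i)) \<inter> space (PiM (past n) innovation) =
        {\<omega> \<in> space (PiM (past n) innovation). X i \<omega> = h i}"
      using X_in_support[OF \<open>past i \<subseteq> past n\<close>] by auto
    finally show "{\<omega> \<in> space (PiM (past n) innovation). X i \<omega> = h i}
        \<in> sets (PiM (past n) innovation)" .
  qed (use J in auto)
  have restr: "restrict \<omega> (past n) \<in> A \<longleftrightarrow> Q \<omega>" if "\<omega> \<in> space \<Omega>" for \<omega>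
  proof -
    have "restrict \<omega> (past n) \<in> space (PiM (past n) innovation)"
      using that by (auto simp: space_PiM)
    moreover have "X i (restrict \<omega> (past n)) = X i \<omega>" if "i \<in> J" for i
      using that J by (intro X_restrict) auto
    ultimately show ?thesis using Q[OF that] by (simp add: A_def)
  qed
  have "{\<omega> \<in> space \<Omega>. X (Suc n) \<omega> = y \<and> Q \<omega>} =
      {\<omega> \<in> space \<Omega>. restrict \<omega> (past n) \<in> A \<and> \<omega> (Suc n, h n) = y}"
    using restr Q J(2) by auto
  moreover have "{\<omega> \<in> space \<Omega>. Q \<omega>} = {\<omega> \<in> space \<Omega>. restrict \<omega> (past n) \<in> A}"
    using restr by auto
  ultimately show ?thesis using prob_past_and_next[OF A] by simp
qed

lemma X_event: "{\<omega> \<in> space \<Omega>. X n \<omega> = y} \<in> sets \<Omega>"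
proof -
  have "X n -` ({y} \<inter> set_pmf (P n)) \<inter> space \<Omega> \<in> sets \<Omega>"
    by (rule measurable_sets[OF measurable_X]) auto
  also have "X n -` ({y} \<inter> set_pmf (P n)) \<inter> space \<Omega> = {\<omega> \<in> space \<Omega>. X n \<omega> = y}"
    using X_in_support[of n UNIV] by auto
  finally show ?thesis .
qed

lemma prob_X: "measure \<Omega> {\<omega> \<in> space \<Omega>. X n \<omega> = y} = pmf (P n) y"
proof (induction n arbitrary: y)
  case 0
  show ?case using prob_coordinate[of 0 undefined y] by (simp add: K_0)
next
  case (Suc n)
  let ?E = "\<lambda>x. {\<omega> \<in> space \<Omega>. X (Suc n) \<omega> = y \<and> X n \<omega> = x}"
  have E: "?E x \<in> sets \<Omega>" for x
  proof -
    have "?E x = {\<omega> \<in> space \<Omega>. X (Suc n) \<omega> = y} \<inter> {\<omega> \<in> space \<Omega>. X n \<omega> = x}" by blast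
    thus ?thesis using X_event[of "Suc n" y] X_event[of n x] by (simp only: sets.Int)
  qed
  have union: "{\<omega> \<in> space \<Omega>. X (Suc n) \<omega> = y} = (\<Union>x\<in>set_pmf (P n). ?E x)"
    using X_in_support[of n UNIV] by blast
  have disj: "disjoint_family_on ?E (set_pmf (P n))"
    unfolding disjoint_family_on_def by blast
  have "measure \<Omega> {\<omega> \<in> space \<Omega>. X (Suc n) \<omega> = y} = (\<Sum>x\<in>set_pmf (P n). measure \<Omega> (?E x))"
    unfolding union by (rule Omega.finite_measure_finite_Union[OF fin _ disj]) (use E in blast)
  also have "\<dots> = (\<Sum>x\<in>set_pmf (P n). pmf (P n) x * pmf (K (Suc n) x) y)"
  proof (rule sum.cong[OF refl])
    fix x
    show "measure \<Omega> (?E x) = pmf (P n) x * pmf (K (Suc n) x) y"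
      using prob_step[of "\<lambda>\<omega>. X n \<omega> = x" "{n}" "\<lambda>_. x" n y] Suc.IH[of x] by simp
  qed
  also have "\<dots> = pmf (P (Suc n)) y"
    unfolding K_Suc[of n, symmetric] using fin by (intro pmf_bind_finite[symmetric]) auto
  finally show ?case .
qed

lemma markov_process_X:
  assumes "countable S" "\<And>n. set_pmf (P n) \<subseteq> S"
  shows "markov_process \<Omega> S X"
  unfolding markov_process_def
proof (intro conjI allI impI ballI)
  show "prob_space \<Omega>" by (rule Omega.prob_space_axioms)
  show "countable S" by fact
  show "X n \<in> measurable \<Omega> (count_space S)" for n
  proof -
    have "X n \<in> measurable \<Omega> (count_space UNIV)"
      by (rule measurable_compose[OF measurable_X[of n UNIV], of "\<lambda>x. x"]) simp_all
    thus ?thesis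
      by (rule measurable_count_space_subset) (rule subsetD[OF assms(2) X_in_support[OF subset_UNIV]])
  qed
  fix n x y
  assume pos: "measure \<Omega> {\<omega> \<in> space \<Omega>. \<forall>i\<le>n. X i \<omega> = x i} > 0"
  have "measure \<Omega> {\<omega> \<in> space \<Omega>. \<forall>i\<le>n. X i \<omega> = x i} \<le> measure \<Omega> {\<omega> \<in> space \<Omega>. X n \<omega> = x n}"
    using X_event by (intro Omega.finite_measure_mono) auto
  hence pos': "measure \<Omega> {\<omega> \<in> space \<Omega>. X n \<omega> = x n} > 0" using pos by linarith
  have "measure \<Omega> {\<omega> \<in> space \<Omega>. X (Suc n) \<omega> = y \<and> (\<forall>i\<le>n. X i \<omega> = x i)}
      = measure \<Omega> {\<omega> \<in> space \<Omega>. \<forall>i\<le>n. X i \<omega> = x i} * pmf (K (Suc n) (x n)) y"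
    by (rule prob_step[where J = "{..n}"]) auto
  moreover have "measure \<Omega> {\<omega> \<in> space \<Omega>. X (Suc n) \<omega> = y \<and> X n \<omega> = x n}
      = measure \<Omega> {\<omega> \<in> space \<Omega>. X n \<omega> = x n} * pmf (K (Suc n) (x n)) y"
    by (rule prob_step[where J = "{n}"]) auto
  ultimately show "cond_prob \<Omega> (\<lambda>\<omega>. X (Suc n) \<omega> = y) (\<lambda>\<omega>. \<forall>i\<le>n. X i \<omega> = x i) =
      cond_prob \<Omega> (\<lambda>\<omega>. X (Suc n) \<omega> = y) (\<lambda>\<omega>. X n \<omega> = x n)"
    using pos pos' by (simp add: cond_prob_def)
qed


end

text \<open>
  The Markov property and the one-dimensional laws only concern the law on the path space.
\<close>

lemma markov_process_path_law:
  assumes markov: "markov_process \<Omega> S X"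
    and Y: "(\<lambda>\<omega> n. X n \<omega>) \<in> measurable \<Omega> N"
    and coord: "\<And>n. (\<lambda>h. h n) \<in> measurable N (count_space S)"
  shows "markov_process (distr \<Omega> N (\<lambda>\<omega> n. X n \<omega>)) S (\<lambda>n h. h n)" (is "markov_process ?M _ _")
    and "measure (distr \<Omega> N (\<lambda>\<omega> n. X n \<omega>)) {h \<in> space N. h n = y} =
           measure \<Omega> {\<omega> \<in> space \<Omega>. X n \<omega> = y}"
proof -
  have event: "{h \<in> space N. h n = y} \<in> sets N" for n y
  proof -
    have "(\<lambda>h. h n) -` ({y} \<inter> S) \<inter> space N \<in> sets N"
      by (rule measurable_sets[OF coord]) simp
    also have "(\<lambda>h. h n) -` ({y} \<inter> S) \<inter> space N = {h \<in> space N. h n = y}"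
      using measurable_space[OF coord, of _ n] by auto
    finally show ?thesis .
  qed
  have past: "{h \<in> space N. \<forall>i\<le>n. h i = x i} \<in> sets N" for n x
    using sets.sets_Collect_finite_All'[of "{..n}" N "\<lambda>i h. h i = x i"] event by auto
  have transfer: "measure ?M {h \<in> space ?M. \<Phi> h} = measure \<Omega> {\<omega> \<in> space \<Omega>. \<Phi> (\<lambda>n. X n \<omega>)}"
    if "{h \<in> space N. \<Phi> h} \<in> sets N" for \<Phi>
  proof -
    have "(\<lambda>\<omega> n. X n \<omega>) -` {h \<in> space N. \<Phi> h} \<inter> space \<Omega> = {\<omega> \<in> space \<Omega>. \<Phi> (\<lambda>n. X n \<omega>)}"
      using measurable_space[OF Y] by auto
    thus ?thesis using that by (simp add: measure_distr[OF Y])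
  qed
  show "measure ?M {h \<in> space N. h n = y} = measure \<Omega> {\<omega> \<in> space \<Omega>. X n \<omega> = y}"
    using transfer[OF event] by simp
  have conj: "{h \<in> space N. A h \<and> B h} \<in> sets N"
    if "{h \<in> space N. A h} \<in> sets N" "{h \<in> space N. B h} \<in> sets N" for A B
    using sets.Int[OF that] by (simp add: Int_def conj_ac cong: conj_cong)
  have M: "prob_space \<Omega>" using markov by (simp add: markov_process_def)
  show "markov_process ?M S (\<lambda>n h. h n)"
    unfolding markov_process_def cond_prob_def
      transfer[OF event] transfer[OF past] transfer[OF conj[OF event past]] transfer[OF conj[OF event event]]
    using markov coord prob_space.prob_space_distr[OF M Y]
    unfolding markov_process_def cond_prob_def by simp
qed

text \<open>
  The paths that satisfy \<open>R\<close> at every step form the sample space. Restricting the product space of paths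
  to them is harmless, as every outcome of the innovations yields such a path.
\<close>

lemma markov_chain_of_couplings:
  fixes P :: "nat \<Rightarrow> 's pmf"
  assumes rel: "\<And>n. rel_pmf R (P n) (P (Suc n))" and fin: "\<And>n. finite (set_pmf (P n))"
    and S: "countable S" "\<And>n. set_pmf (P n) \<subseteq> S"
  obtains M :: "(nat \<Rightarrow> 's) measure" where
    "markov_process M S (\<lambda>n h. h n)"
    "\<And>n h. h \<in> space M \<Longrightarrow> h n \<in> set_pmf (P n)"
    "\<And>n h. h \<in> space M \<Longrightarrow> R (h n) (h (Suc n))"
    "\<And>n y. measure M {h \<in> space M. h n = y} = pmf (P n) y"
proof -
  have "\<exists>K. bind_pmf (P n) K = P (Suc n) \<and> (\<forall>x\<in>set_pmf (P n). \<forall>y\<in>set_pmf (K x). R x y)" for n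
    by (rule rel_pmf_kernel[OF rel[of n]]) blast
  then obtain L where L: "\<And>n. bind_pmf (P n) (L n) = P (Suc n)"
    "\<And>n x y. x \<in> set_pmf (P n) \<Longrightarrow> y \<in> set_pmf (L n x) \<Longrightarrow> R x y"
    by metis
  define K where "K n = (case n of 0 \<Rightarrow> (\<lambda>_. P 0) | Suc m \<Rightarrow> L m)" for n
  interpret kernel_chain P K
    by unfold_locales (auto simp: K_def L fin)
  \<comment> \<open>The chain lives on innovations; its law is transported to the space of paths that respect \<open>R\<close>.\<close>
  define good where "good = {h. \<forall>n. R (h n) (h (Suc n))}"
  define N where "N = restrict_space (PiM UNIV (\<lambda>n. count_space (set_pmf (P n)))) good"
  have R: "R (X n \<omega>) (X (Suc n) \<omega>)" if "\<omega> \<in> space \<Omega>" for n \<omega>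
  proof (rule L(2)[of _ n])
    show "X n \<omega> \<in> set_pmf (P n)" by (rule X_in_support[OF subset_UNIV that])
    have "\<omega> (Suc n, X n \<omega>) \<in> space (innovation (Suc n, X n \<omega>))"
      using that by (auto simp: space_PiM PiE_def)
    thus "X (Suc n) \<omega> \<in> set_pmf (L n (X n \<omega>))" by (simp add: space_innovation K_def)
  qed
  have Y: "(\<lambda>\<omega> n. X n \<omega>) \<in> measurable \<Omega> N"
    unfolding N_def
  proof (rule measurable_restrict_space2)
    show "(\<lambda>\<omega> n. X n \<omega>) \<in> space \<Omega> \<rightarrow> good" using R by (auto simp: good_def)
    show "(\<lambda>\<omega> n. X n \<omega>) \<in> measurable \<Omega> (PiM UNIV (\<lambda>n. count_space (set_pmf (P n))))"
      by (rule measurable_PiM_single')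
         (auto intro: measurable_X[OF subset_UNIV] X_in_support[OF subset_UNIV] simp del: X.simps)
  qed
  have space_N: "h n \<in> set_pmf (P n)" "R (h n) (h (Suc n))" if "h \<in> space N" for h n
    using that by (auto simp: N_def good_def space_restrict_space space_PiM)
  have coord: "(\<lambda>h. h n) \<in> measurable N (count_space S)" for n
  proof (rule measurable_count_space_subset)
    have "(\<lambda>h. h n) \<in> measurable N (count_space (set_pmf (P n)))"
      unfolding N_def by (intro measurable_restrict_space1 measurable_component_singleton) simp
    thus "(\<lambda>h. h n) \<in> measurable N (count_space UNIV)"
      by (rule measurable_compose) simp
    show "h n \<in> S" if "h \<in> space N" for h using space_N(1)[OF that] S(2) by blast
  qed
  note path = markov_process_path_law[OF markov_process_X[OF S] Y coord]
  show thesis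
  proof (rule that[of "distr \<Omega> N (\<lambda>\<omega> n. X n \<omega>)"])
    show "markov_process (distr \<Omega> N (\<lambda>\<omega> n. X n \<omega>)) S (\<lambda>n h. h n)" by (rule path(1))
    show "measure (distr \<Omega> N (\<lambda>\<omega> n. X n \<omega>)) {h \<in> space (distr \<Omega> N (\<lambda>\<omega> n. X n \<omega>)). h n = y}
        = pmf (P n) y" for n y
      by (simp only: space_distr path(2) prob_X)
  qed (use space_N in simp_all)
qed

section \<open>The Markov process of conditioned trees\<close>

context log_concave_offspring
begin

text \<open>
  The law of \<open>T\<^sub>n\<^sub>d\<^sub>+\<^sub>1\<close>: the vertices other than the root form a forest of \<open>nd\<close> vertices in state 0.
\<close>

definition tree_law :: "nat \<Rightarrow> nat list set pmf" where
  "tree_law n = map_pmf (\<lambda>f. insert [] (vertices f)) (forest_law \<mu> 0 (n * d))"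

lemma fmass_multiple_pos: "fmass \<mu> 0 (n * d) > 0"
  using a_pos[of n] by (simp add: G_def mult.commute)

lemma tree_law_step: "rel_pmf (\<subseteq>) (tree_law n) (tree_law (Suc n))"
proof -
  have "rel_pmf (\<lambda>f g. vertices f \<subseteq> vertices g) (forest_law \<mu> 0 (n * d)) (forest_law \<mu> 0 (n * d + d))"
    using fmass_multiple_pos[of n] fmass_multiple_pos[of "Suc n"]
    by (intro forest_law_step) (simp_all add: add.commute)
  hence "rel_pmf (\<lambda>f g. insert [] (vertices f) \<subseteq> insert [] (vertices g))
      (forest_law \<mu> 0 (n * d)) (forest_law \<mu> 0 (n * d + d))"
    by (rule pmf.rel_mono_strong) blast
  thus ?thesis by (simp add: tree_law_def pmf.rel_map add.commute)
qed

lemma set_tree_law: "set_pmf (tree_law n) \<subseteq> plane_trees_of_size (n * d + 1)"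
proof
  fix T assume "T \<in> set_pmf (tree_law n)"
  then obtain f where f: "T = insert [] (vertices f)" "f \<in> set_pmf (forest_law \<mu> 0 (n * d))"
    by (auto simp: tree_law_def)
  hence "fsize f = n * d"
    by (auto simp: set_pmf_iff pmf_forest_law[OF fmass_multiple_pos] split: if_splits)
  thus "T \<in> plane_trees_of_size (n * d + 1)"
    using bij_betwE[OF bij_betw_tree[of "n * d"]] f by simp
qed

lemma pmf_tree_law:
  assumes "T \<in> plane_trees_of_size (n * d + 1)"
  shows "pmf (tree_law n) T = bgw_weight \<mu> T / bgw_mass \<mu> (n * d + 1)"
proof -
  obtain f where f: "fsize f = n * d" "T = insert [] (vertices f)"
    using assms bij_betw_imp_surj_on[OF bij_betw_tree[of "n * d"]] by auto
  have "inj (\<lambda>f. insert [] (vertices f))"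
  proof (rule injI)
    fix f g assume "insert [] (vertices f) = insert [] (vertices g)"
    hence "vertices f = vertices g" by (rule insert_ident[THEN iffD1, rotated 2]) auto
    thus "f = g" by (rule vertices_inj)
  qed
  hence "pmf (tree_law n) T = pmf (forest_law \<mu> 0 (n * d)) f"
    unfolding tree_law_def f by (rule pmf_map_inj')
  thus ?thesis
    using bgw_mass_eq[of \<mu> "n * d"] f
    by (simp add: pmf_forest_law[OF fmass_multiple_pos] bgw_weight_tree)
qed

lemma distr_eq_bgw_cond:
  assumes M: "prob_space M"
    and X: "X \<in> measurable M (count_space (plane_trees_of_size (n * d + 1)))"
    and law: "\<And>T. measure M {\<omega> \<in> space M. X \<omega> = T} = pmf (tree_law n) T"
  shows "distr M (count_space (plane_trees_of_size (n * d + 1))) X = bgw_cond \<mu> (n * d + 1)"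
proof (rule measure_eqI_finite[where A = "plane_trees_of_size (n * d + 1)"])
  let ?S = "plane_trees_of_size (n * d + 1)"
  show "finite ?S" by (rule finite_plane_trees_of_size)
  fix T assume T: "T \<in> ?S"
  have "emeasure (distr M (count_space ?S) X) {T} = emeasure M (X -` {T} \<inter> space M)"
    using T by (intro emeasure_distr[OF X]) simp
  also have "X -` {T} \<inter> space M = {\<omega> \<in> space M. X \<omega> = T}" by auto
  also have "emeasure M \<dots> = ennreal (bgw_weight \<mu> T / bgw_mass \<mu> (n * d + 1))"
    using finite_measure.emeasure_eq_measure[OF prob_space.finite_measure[OF M]]
    by (simp only: law pmf_tree_law[OF T])
  also have "\<dots> = emeasure (bgw_cond \<mu> (n * d + 1)) {T}"
    unfolding bgw_cond_def using T
    by (subst emeasure_point_measure_finite) (auto simp: finite_plane_trees_of_size)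
  finally show "emeasure (distr M (count_space ?S) X) {T} = emeasure (bgw_cond \<mu> (n * d + 1)) {T}" .
qed (simp_all add: bgw_cond_def sets_point_measure)

end

lemma countable_plane_trees: "countable plane_trees"
proof -
  have "plane_trees = (\<Union>n. plane_trees_of_size n)" by (auto simp: plane_trees_of_size_def)
  also have "countable \<dots>"
    by (rule countable_UN) (simp_all add: countable_finite finite_plane_trees_of_size)
  finally show ?thesis .
qed

theorem theorem2:
  fixes \<mu> :: "nat pmf" and d :: nat
  assumes "0 < pmf \<mu> 0" and "pmf \<mu> 0 < 1"
    and "d \<ge> 1" and "set_pmf \<mu> \<subseteq> {k. d dvd k}"
    and "log_concave_seq (\<lambda>k. pmf \<mu> (k * d))"
  shows "\<exists>(M :: (nat \<Rightarrow> nat list set) measure) (T :: nat \<Rightarrow> (nat \<Rightarrow> nat list set) \<Rightarrow> nat list set).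
           prob_space M \<and>
           markov_process M plane_trees T \<and>
           (\<forall>n. T n \<in> measurable M (count_space (plane_trees_of_size (n * d + 1))) \<and>
                distr M (count_space (plane_trees_of_size (n * d + 1))) (T n)
                  = bgw_cond \<mu> (n * d + 1)) \<and>
           (\<forall>n. \<forall>\<omega>\<in>space M. T n \<omega> \<subseteq> T (Suc n) \<omega>)"
proof -
  interpret log_concave_offspring \<mu> d
    using assms by unfold_locales
  have sub: "set_pmf (tree_law n) \<subseteq> plane_trees" for n
    using set_tree_law[of n] by (auto simp: plane_trees_of_size_def)
  have fin: "finite (set_pmf (tree_law n))" for n
    using set_tree_law finite_plane_trees_of_size by (rule finite_subset)
  obtain M :: "(nat \<Rightarrow> nat list set) measure" where M:
    "markov_process M plane_trees (\<lambda>n h. h n)"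
    "\<And>n h. h \<in> space M \<Longrightarrow> h n \<in> set_pmf (tree_law n)"
    "\<And>n h. h \<in> space M \<Longrightarrow> h n \<subseteq> h (Suc n)"
    "\<And>n T. measure M {h \<in> space M. h n = T} = pmf (tree_law n) T"
  proof (rule markov_chain_of_couplings[where P = tree_law and R = "(\<subseteq>)",
        OF tree_law_step fin countable_plane_trees sub], goal_cases)
    case (1 M)
    show ?case by (rule that) (fact 1)+
  qed
  have prob: "prob_space M" using M(1) by (simp add: markov_process_def)
  have meas: "(\<lambda>h. h n) \<in> measurable M (count_space (plane_trees_of_size (n * d + 1)))" for n
  proof (rule measurable_count_space_subset)
    have "(\<lambda>h. h n) \<in> measurable M (count_space plane_trees)"
      using M(1) by (simp add: markov_process_def)
    thus "(\<lambda>h. h n) \<in> measurable M (count_space UNIV)" by (rule measurable_compose) simp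
    show "h n \<in> plane_trees_of_size (n * d + 1)" if "h \<in> space M" for h
      using M(2)[OF that] set_tree_law by blast
  qed
  have law: "distr M (count_space (plane_trees_of_size (n * d + 1))) (\<lambda>h. h n)
      = bgw_cond \<mu> (n * d + 1)" for n
    by (rule distr_eq_bgw_cond[OF prob meas M(4)])
  show ?thesis
    by (intro exI[of _ M] exI[of _ "\<lambda>n h. h n"] conjI allI ballI prob M(1,3) meas law)
qed

end
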